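(* The fiber of the projection $$\mathrm{Sh}_{P(\widehat{\mathbb{Z}})}(P,\overline{Y_P})\to \mathrm{Sh}_{\mathrm{GL}_2(\widehat{\mathbb{Z}})}(\mathrm{GL}_2,\mathbb{P}^1(\mathbb{R}))=\mathrm{PGL}_2(\mathbb{Z})\backslash\mathbb{P}^1(\mathbb{R})$$ over a point $(M,F_0)$ of the space of pre-lilacs is the space $M\backslash M_{\mathbb{R}}/F_0$ of leaves of the corresponding linear foliation on the two-torus $M\backslash M_{\mathbb{R}}$.
   Context: A pre-Shimura datum is a pair $(P,X)$ of a $\mathbb{Q}$-algebraic group $P$ and a left $P(\mathbb{R})$-space $X$. For a compact open subgroup $K\subset P(\mathbb{A}_f)$ ($\mathbb{A}_f$ the finite adeles of $\mathbb{Q}$), $\mathrm{Sh}_K(P,X):=P(\mathbb{Q})\backslash (X\times P(\mathbb{A}_f)/K)$. A morphism $(P_1,X_1)\to(P_2,X_2)$ is a pair of a group morphism $P_1\to P_2$ and a $P_1(\mathbb{R})$-equivariant map $X_1\to X_2$; it induces maps between the corresponding sets $\mathrm{Sh}$ for compatible levels. A (rank 2) pre-lilac is a pair $(M,F)$ of a free $\mathbb{Z}$-module $M$ of rank two and a real line $F\subset M_{\mathbb{R}}:=M\otimes_{\mathbb{Z}}\mathbb{R}$. $\mathbb{P}^1(\mathbb{R})$ is the space of lines in $\mathbb{R}^2$ with its natural left $\mathrm{GL}_2(\mathbb{R})$-action; the set of isomorphism classes of pre-lilacs is $\mathrm{GL}_2(\mathbb{Z})\backslash\mathbb{P}^1(\mathbb{R})=\mathrm{PGL}_2(\mathbb{Z})\backslash\mathbb{P}^1(\mathbb{R})$,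 a line $F_0\subset\mathbb{R}^2$ corresponding to $(\mathbb{Z}^2,F_0)$. Let $h_0':\mathbb{G}_{m,\mathbb{R}}^2\to \mathrm{GL}_{2,\mathbb{R}}$, $(x,y)\mapsto \begin{pmatrix} xy&0\\0&1\end{pmatrix}$, and let $X'$ be its $\mathrm{GL}_2(\mathbb{R})$-conjugacy class. It is the set of pairs $(F_{xy},F_0)$ of distinct lines in $\mathbb{R}^2$, where $(x,y)$ acts by $xy$ on $F_{xy}$ and trivially on $F_0$. There is a projection $X'\to\mathbb{P}^1(\mathbb{R})$, $(F_{xy},F_0)\mapsto F_0$. Let $V:=\mathbb{G}_a^2$ be the standard representation of $\mathrm{GL}_2$ (with $V(\mathbb{Z})=\mathbb{Z}^2$) and $P:=V\rtimes \mathrm{GL}_2$. Also denote by $h_0':\mathbb{G}_{m,\mathbb{R}}^2\to P_{\mathbb{R}}$ the composite of $h_0'$ with a rational section of the projection $P\to \mathrm{GL}_2$ (for example $g\mapsto(0,g)$), and let $Y_P$ be its $P(\mathbb{R})$-conjugacy class, which is independent of the chosen section. Let $V_P=\mathbb{Q}^3$ be the standard representation of $P$ given by the embedding $P\hookrightarrow\mathrm{GL}_3$, $(v,A)\mapsto\begin{pmatrix}A&v\\0&1\end{pmatrix}$. For $h\in Y_P$ put $F^0(h):=\{v\in V_{P,\mathbb{R}} : h(x,y)\cdot v=v \text{ for all } (x,y)\in(\mathbb{R}^* )^2\}$. Define an equivalence relation on $Y_P$ by $h\sim h'\Leftrightarrow F^0(h)=F^0(h')$, and let $\overline{Y_P}:=Y_P/\sim$.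 The projection $P\to\mathrm{GL}_2$ together with $Y_P\to X'\to\mathbb{P}^1(\mathbb{R})$ induces a morphism of pre-Shimura data $(P,\overline{Y_P})\to(\mathrm{GL}_2,\mathbb{P}^1(\mathbb{R}))$, which gives the projection in the claim.
   Formalization: The fiber is taken over the pre-lilac itself (points with an identification of their image with it, modulo P(Q)), since the fiber over its class in the orbit set is only the leaf space modulo Aut(M,F_0), as -1 identifies v with -v; that relation is also stated. *)

theory Defs
  imports "HOL-Analysis.Analysis" "HOL-Algebra.Left_Coset"
begin

section \<open>Finite adeles of the rationals\<close>

text \<open>
  The profinite integers as the inverse limit of the rings of residues modulo
  \<open>n > 0\<close>, ordered by divisibility; \<open>f n\<close> is the representative in \<open>{0..<n}\<close>
  of the component modulo \<open>n\<close>. The index \<open>0\<close> plays no role and is normalised to \<open>f 0 = 0\<close>.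
\<close>

typedef zhat = "{f :: nat \<Rightarrow> int. f 0 = 0 \<and> (\<forall>m n. n > 0 \<longrightarrow> m dvd n \<longrightarrow> f n mod int m = f m)}"
  morphisms residue Abs_zhat
  by (rule exI[of _ "\<lambda>_. 0"]) simp

setup_lifting type_definition_zhat

instantiation zhat :: comm_ring_1
begin

lift_definition zero_zhat :: zhat is "\<lambda>_. 0" by simp

lift_definition one_zhat :: zhat is "\<lambda>n. if n = 0 then 0 else 1 mod int n"
  by (auto simp: mod_mod_cancel)

lift_definition plus_zhat :: "zhat \<Rightarrow> zhat \<Rightarrow> zhat" is "\<lambda>f g n. (f n + g n) mod int n"
  by (simp add: mod_mod_cancel) (metis mod_add_eq)

lift_definition uminus_zhat :: "zhat \<Rightarrow> zhat" is "\<lambda>f n. (- f n) mod int n"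
  by (simp add: mod_mod_cancel) (metis mod_minus_eq)

lift_definition minus_zhat :: "zhat \<Rightarrow> zhat \<Rightarrow> zhat" is "\<lambda>f g n. (f n - g n) mod int n"
  by (simp add: mod_mod_cancel) (metis mod_diff_eq)

lift_definition times_zhat :: "zhat \<Rightarrow> zhat \<Rightarrow> zhat" is "\<lambda>f g n. (f n * g n) mod int n"
  by (simp add: mod_mod_cancel) (metis mod_mult_eq)

lemma residue_0 [simp]: "residue a 0 = 0"
  using residue[of a] by blast

lemma residue_dvd: "n > 0 \<Longrightarrow> m dvd n \<Longrightarrow> residue a n mod int m = residue a m"
  using residue[of a] by blast

lemma residue_mod [simp]: "residue a n mod int n = residue a n"
  using residue_dvd[of n n a] by (cases "n = 0") simp_all

lemma zhat_eqI: "(\<And>n. residue a n = residue b n) \<Longrightarrow> a = b"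
  using residue_inject by blast

instance
proof
  fix a b c :: zhat
  show "a * b * c = a * (b * c)"
    by transfer (auto simp: fun_eq_iff mod_simps mult.assoc)
  show "a * b = b * a"
    by transfer (simp add: mult.commute)
  show "1 * a = a"
    by (rule zhat_eqI) (simp add: times_zhat.rep_eq one_zhat.rep_eq mod_mult_left_eq)
  show "a + b + c = a + (b + c)"
    by transfer (auto simp: fun_eq_iff mod_simps add.assoc)
  show "a + b = b + a"
    by transfer (simp add: add.commute)
  show "0 + a = a"
    by (rule zhat_eqI) (simp add: plus_zhat.rep_eq zero_zhat.rep_eq)
  show "- a + a = 0"
    by transfer (auto simp: fun_eq_iff mod_simps)
  show "a - b = a + - b"
    by transfer (auto simp: fun_eq_iff mod_simps)
  show "(a + b) * c = a * c + b * c"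
    by (rule zhat_eqI) (simp only: times_zhat.rep_eq plus_zhat.rep_eq mod_simps distrib_right)
  have "residue 0 2 \<noteq> residue 1 2"
    by (simp add: zero_zhat.rep_eq one_zhat.rep_eq)
  thus "(0 :: zhat) \<noteq> 1"
    by metis
qed

end

lemma residue_of_nat: "n > 0 \<Longrightarrow> residue (of_nat k) n = int k mod int n"
  by (induction k)
    (auto simp: zero_zhat.rep_eq one_zhat.rep_eq plus_zhat.rep_eq mod_simps add.commute)

lemma residue_of_int: "n > 0 \<Longrightarrow> residue (of_int k) n = k mod int n"
  by (cases k rule: int_cases2) (simp_all add: residue_of_nat uminus_zhat.rep_eq mod_simps)

lemma residue_times: "residue (a * b) n = (residue a n * residue b n) mod int n"
  by (simp add: times_zhat.rep_eq)

lemma zhat_torsion_free: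
  assumes "of_int k * a = (of_int k * b :: zhat)" "k \<noteq> 0"
  shows "a = b"
proof -
  have "residue a n = residue b n" if n: "n > 0" for n
  proof -
    define N where "N = nat \<bar>k\<bar> * n"
    have N: "N > 0" "n dvd N" and intN: "int N = \<bar>k\<bar> * int n"
      using n assms(2) by (auto simp: N_def)
    have "residue (of_int k * a) N = residue (of_int k * b) N"
      using assms(1) by simp
    hence "(k * residue a N) mod int N = (k * residue b N) mod int N"
      using N by (simp add: residue_times residue_of_int mod_simps)
    hence "\<bar>k\<bar> * int n dvd k * (residue a N - residue b N)"
      by (simp add: mod_eq_dvd_iff intN right_diff_distrib)
    hence "int n dvd residue a N - residue b N"
      using assms(2) by (cases "k > 0") (auto simp: abs_if)
    hence "residue a N mod int n = residue b N mod int n"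
      by (simp add: mod_eq_dvd_iff)
    thus ?thesis
      using residue_dvd[OF N] by simp
  qed
  hence "residue a n = residue b n" for n
    by (cases "n = 0") simp_all
  thus ?thesis
    by (rule zhat_eqI)
qed

lifting_update zhat.lifting
lifting_forget zhat.lifting

text \<open>
  The finite adeles as the localisation of the profinite integers at the nonzero integers, that is,
  the tensor product of the profinite integers with the rationals over the integers; a pair
  \<open>(a, n)\<close> with \<open>n \<noteq> 0\<close> stands for the fraction \<open>a / n\<close>.
\<close>

definition fin_adele_rel :: "zhat \<times> int \<Rightarrow> zhat \<times> int \<Rightarrow> bool"
  where "fin_adele_rel x y \<longleftrightarrow>
    snd x \<noteq> 0 \<and> snd y \<noteq> 0 \<and> fst x * of_int (snd y) = fst y * of_int (snd x)"

lemma part_equivp_fin_adele_rel: "part_equivp fin_adele_rel"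
proof (rule part_equivpI)
  show "\<exists>x. fin_adele_rel x x"
    by (rule exI[of _ "(0, 1)"]) (simp add: fin_adele_rel_def)
  show "symp fin_adele_rel"
    by (auto simp: symp_def fin_adele_rel_def)
  show "transp fin_adele_rel"
  proof (rule transpI)
    fix x y z assume xy: "fin_adele_rel x y" and yz: "fin_adele_rel y z"
    have "of_int (snd y) * (fst x * of_int (snd z)) = (fst x * of_int (snd y)) * of_int (snd z)"
      by (simp add: mult_ac)
    also have "\<dots> = (fst y * of_int (snd z)) * of_int (snd x)"
      using xy by (simp add: fin_adele_rel_def mult_ac)
    also have "\<dots> = of_int (snd y) * (fst z * of_int (snd x))"
      using yz by (simp add: fin_adele_rel_def mult_ac)
    finally have "fst x * of_int (snd z) = fst z * of_int (snd x)"
      by (rule zhat_torsion_free) (use yz in \<open>simp add: fin_adele_rel_def\<close>)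
    thus "fin_adele_rel x z"
      using xy yz by (simp add: fin_adele_rel_def)
  qed
qed

quotient_type fin_adele = "zhat \<times> int" / partial: fin_adele_rel
  morphisms Rep_fin_adele Abs_fin_adele
  by (rule part_equivp_fin_adele_rel)

lift_definition adele_fract :: "zhat \<Rightarrow> int \<Rightarrow> fin_adele"
  is "\<lambda>a n. if n = 0 then (0, 1) else (a, n)"
  by (simp add: fin_adele_rel_def)

instantiation fin_adele :: comm_ring_1
begin

lift_definition zero_fin_adele :: fin_adele is "(0, 1)"
  by (simp add: fin_adele_rel_def)

lift_definition one_fin_adele :: fin_adele is "(1, 1)"
  by (simp add: fin_adele_rel_def)

lift_definition plus_fin_adele :: "fin_adele \<Rightarrow> fin_adele \<Rightarrow> fin_adele"
  is "\<lambda>x y. (fst x * of_int (snd y) + fst y * of_int (snd x), snd x * snd y)"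
proof -
  fix x x' y y' assume x: "fin_adele_rel x x'" and y: "fin_adele_rel y y'"
  have ex: "fst x * of_int (snd x') = fst x' * of_int (snd x)"
    and ey: "fst y * of_int (snd y') = fst y' * of_int (snd y)"
    using x y by (auto simp: fin_adele_rel_def)
  have "(fst x * of_int (snd y) + fst y * of_int (snd x)) * of_int (snd x' * snd y') =
      (fst x * of_int (snd x')) * of_int (snd y * snd y') +
      (fst y * of_int (snd y')) * of_int (snd x * snd x')"
    by (simp add: algebra_simps)
  also have "\<dots> = (fst x' * of_int (snd y') + fst y' * of_int (snd x')) * of_int (snd x * snd y)"
    unfolding ex ey by (simp add: algebra_simps)
  finally show "fin_adele_rel
      (fst x * of_int (snd y) + fst y * of_int (snd x), snd x * snd y)
      (fst x' * of_int (snd y') + fst y' * of_int (snd x'), snd x' * snd y')"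
    using x y by (simp add: fin_adele_rel_def)
qed

lift_definition uminus_fin_adele :: "fin_adele \<Rightarrow> fin_adele" is "\<lambda>x. (- fst x, snd x)"
  by (simp add: fin_adele_rel_def)

definition minus_fin_adele :: "fin_adele \<Rightarrow> fin_adele \<Rightarrow> fin_adele"
  where "minus_fin_adele x y = x + - y"

lift_definition times_fin_adele :: "fin_adele \<Rightarrow> fin_adele \<Rightarrow> fin_adele"
  is "\<lambda>x y. (fst x * fst y, snd x * snd y)"
proof -
  fix x x' y y' assume x: "fin_adele_rel x x'" and y: "fin_adele_rel y y'"
  have "fst x * fst y * of_int (snd x' * snd y') =
      (fst x * of_int (snd x')) * (fst y * of_int (snd y'))"
    by (simp add: algebra_simps)
  also have "\<dots> = (fst x' * of_int (snd x)) * (fst y' * of_int (snd y))"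
    using x y by (simp add: fin_adele_rel_def)
  finally show "fin_adele_rel (fst x * fst y, snd x * snd y) (fst x' * fst y', snd x' * snd y')"
    using x y by (simp add: fin_adele_rel_def del: of_int_mult) (simp add: mult_ac)
qed

instance
proof
  fix a b c :: fin_adele
  show "a * b * c = a * (b * c)"
    by transfer (simp add: fin_adele_rel_def algebra_simps)
  show "a * b = b * a"
    by transfer (simp add: fin_adele_rel_def algebra_simps)
  show "1 * a = a"
    by transfer (simp add: fin_adele_rel_def)
  show "a + b + c = a + (b + c)"
    by transfer (simp add: fin_adele_rel_def algebra_simps)
  show "a + b = b + a"
    by transfer (simp add: fin_adele_rel_def algebra_simps)
  show "0 + a = a"
    by transfer (simp add: fin_adele_rel_def)
  show "- a + a = 0"
    by transfer (simp add: fin_adele_rel_def)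
  show "a - b = a + - b"
    by (simp add: minus_fin_adele_def)
  show "(a + b) * c = a * c + b * c"
    by transfer (simp add: fin_adele_rel_def algebra_simps)
  show "(0 :: fin_adele) \<noteq> 1"
    by transfer (simp add: fin_adele_rel_def)
qed

end

lifting_update fin_adele.lifting
lifting_forget fin_adele.lifting

definition zhat_to_adele :: "zhat \<Rightarrow> fin_adele"
  where "zhat_to_adele a = adele_fract a 1"

definition rat_to_adele :: "rat \<Rightarrow> fin_adele"
  where "rat_to_adele q = adele_fract (of_int (fst (quotient_of q))) (snd (quotient_of q))"


section \<open>Pre-Shimura data and their Shimura spaces\<close>

definition quotient_topology :: "'a topology \<Rightarrow> ('a \<Rightarrow> 'b) \<Rightarrow> 'b topology"
  where "quotient_topology X f =
    topology (\<lambda>U. U \<subseteq> f ` topspace X \<and> openin X {x \<in> topspace X. f x \<in> U})"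

lemma openin_quotient_topology:
  "openin (quotient_topology X f) U \<longleftrightarrow>
    U \<subseteq> f ` topspace X \<and> openin X {x \<in> topspace X. f x \<in> U}"
proof -
  have "istopology (\<lambda>U. U \<subseteq> f ` topspace X \<and> openin X {x \<in> topspace X. f x \<in> U})"
    unfolding istopology_def
  proof (intro conjI allI impI; (elim conjE)?)
    fix S T
    assume "S \<subseteq> f ` topspace X" "openin X {x \<in> topspace X. f x \<in> S}"
      "T \<subseteq> f ` topspace X" "openin X {x \<in> topspace X. f x \<in> T}"
    moreover have "{x \<in> topspace X. f x \<in> S \<inter> T} =
        {x \<in> topspace X. f x \<in> S} \<inter> {x \<in> topspace X. f x \<in> T}"
      by blast
    ultimately show "S \<inter> T \<subseteq> f ` topspace X" "openin X {x \<in> topspace X. f x \<in> S \<inter> T}"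
      by auto
  next
    fix \<K> assume \<K>: "\<forall>K\<in>\<K>. K \<subseteq> f ` topspace X \<and> openin X {x \<in> topspace X. f x \<in> K}"
    have "{x \<in> topspace X. f x \<in> \<Union>\<K>} = (\<Union>K\<in>\<K>. {x \<in> topspace X. f x \<in> K})"
      by blast
    with \<K> show "\<Union>\<K> \<subseteq> f ` topspace X" "openin X {x \<in> topspace X. f x \<in> \<Union>\<K>}"
      by auto
  qed
  thus ?thesis
    by (simp add: quotient_topology_def)
qed

lemma topspace_quotient_topology [simp]: "topspace (quotient_topology X f) = f ` topspace X"
proof -
  have "{x \<in> topspace X. f x \<in> f ` topspace X} = topspace X"
    by blast
  hence "openin (quotient_topology X f) (f ` topspace X)"
    by (simp add: openin_quotient_topology)
  moreover have "topspace (quotient_topology X f) \<subseteq> f ` topspace X"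
    using openin_topspace[of "quotient_topology X f"] unfolding openin_quotient_topology by (rule conjunct1)
  ultimately show ?thesis
    by (simp add: openin_subset subset_antisym)
qed

lemma quotient_map_quotient_topology: "quotient_map X (quotient_topology X f) f"
  by (auto simp: quotient_map_def openin_quotient_topology)

text \<open>
  A rational algebraic group \<open>P\<close> enters through its groups of points over the rationals, the reals
  and the finite adeles, and the two maps from the rational points.
\<close>

record ('q, 'r, 'a, 'x) pre_shimura_datum =
  rat_pts :: "'q monoid"
  real_pts :: "'r monoid"
  adele_pts :: "'a monoid"
  to_real :: "'q \<Rightarrow> 'r"
  to_adele :: "'q \<Rightarrow> 'a"
  sym_space :: "'x topology"
  action :: "'r \<Rightarrow> 'x \<Rightarrow> 'x"

text \<open>
  A morphism is recorded by its effect on rational and adelic points and on the spaces; the effect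
  on real points plays no role in what follows.
\<close>

record ('q1, 'a1, 'x1, 'q2, 'a2, 'x2) pre_shimura_morphism =
  on_rat :: "'q1 \<Rightarrow> 'q2"
  on_adele :: "'a1 \<Rightarrow> 'a2"
  on_space :: "'x1 \<Rightarrow> 'x2"

text \<open>
  The space \<open>X \<times> P(A_f)/K\<close>. The level \<open>K\<close> is an open subgroup, so \<open>P(A_f)/K\<close> is discrete.
\<close>

definition level_space ::
    "('q, 'r, 'a, 'x) pre_shimura_datum \<Rightarrow> 'a set \<Rightarrow> ('x \<times> 'a set) topology"
  where "level_space D K =
    prod_topology (sym_space D) (discrete_topology (lcosets\<^bsub>adele_pts D\<^esub> K))"

definition level_act ::
    "('q, 'r, 'a, 'x) pre_shimura_datum \<Rightarrow> 'q \<Rightarrow> 'x \<times> 'a set \<Rightarrow> 'x \<times> 'a set"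
  where "level_act D q =
    (\<lambda>(x, c). (action D (to_real D q) x, to_adele D q <#\<^bsub>adele_pts D\<^esub> c))"

definition Sh_class ::
    "('q, 'r, 'a, 'x) pre_shimura_datum \<Rightarrow> 'x \<times> 'a set \<Rightarrow> ('x \<times> 'a set) set"
  where "Sh_class D s = (\<lambda>q. level_act D q s) ` carrier (rat_pts D)"

definition Sh ::
    "('q, 'r, 'a, 'x) pre_shimura_datum \<Rightarrow> 'a set \<Rightarrow> ('x \<times> 'a set) set topology"
  where "Sh D K = quotient_topology (level_space D K) (Sh_class D)"

definition level_map ::
    "('q1, 'a1, 'x1, 'q2, 'a2, 'x2) pre_shimura_morphism \<Rightarrow>
     ('q2, 'r2, 'a2, 'x2) pre_shimura_datum \<Rightarrow> 'a2 set \<Rightarrow> 'x1 \<times> 'a1 set \<Rightarrow> 'x2 \<times> 'a2 set"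
  where "level_map m D2 K2 =
    (\<lambda>(x, c). (on_space m x, on_adele m ` c <#>\<^bsub>adele_pts D2\<^esub> K2))"

definition Sh_map ::
    "('q1, 'a1, 'x1, 'q2, 'a2, 'x2) pre_shimura_morphism \<Rightarrow>
     ('q2, 'r2, 'a2, 'x2) pre_shimura_datum \<Rightarrow> 'a2 set \<Rightarrow>
     ('x1 \<times> 'a1 set) set \<Rightarrow> ('x2 \<times> 'a2 set) set"
  where "Sh_map m D2 K2 c = the_elem ((\<lambda>s. Sh_class D2 (level_map m D2 K2 s)) ` c)"

text \<open>
  The fibre of \<open>Sh\<^bsub>K1\<^esub>(D1) \<rightarrow> Sh\<^bsub>K2\<^esub>(D2)\<close> over an object \<open>t\<close> of \<open>X2 \<times> P2(A_f)/K2\<close> (not merely over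
  its class): a point is a pair \<open>(s, g)\<close> of a point \<open>s\<close> of \<open>X1 \<times> P1(A_f)/K1\<close> and an identification
  \<open>g\<close> of the image of \<open>s\<close> with \<open>t\<close>, taken up to the simultaneous action of \<open>P1(Q)\<close>. Forgetting
  \<open>g\<close> maps it onto the subset of \<open>Sh\<^bsub>K1\<^esub>(D1)\<close> lying over the class of \<open>t\<close>. That subset is
  in general smaller: it is the quotient of the fibre by the automorphisms of \<open>t\<close>.
\<close>

definition fibre_objects ::
    "('q1, 'a1, 'x1, 'q2, 'a2, 'x2) pre_shimura_morphism \<Rightarrow>
     ('q1, 'r1, 'a1, 'x1) pre_shimura_datum \<Rightarrow> 'a1 set \<Rightarrow>
     ('q2, 'r2, 'a2, 'x2) pre_shimura_datum \<Rightarrow> 'a2 set \<Rightarrow>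
     'x2 \<times> 'a2 set \<Rightarrow> (('x1 \<times> 'a1 set) \<times> 'q2) topology"
  where "fibre_objects m D1 K1 D2 K2 t =
    subtopology
      (prod_topology (level_space D1 K1) (discrete_topology (carrier (rat_pts D2))))
      {(s, g). level_act D2 g (level_map m D2 K2 s) = t}"

definition fibre_class ::
    "('q1, 'a1, 'x1, 'q2, 'a2, 'x2) pre_shimura_morphism \<Rightarrow>
     ('q1, 'r1, 'a1, 'x1) pre_shimura_datum \<Rightarrow> ('q2, 'r2, 'a2, 'x2) pre_shimura_datum \<Rightarrow>
     ('x1 \<times> 'a1 set) \<times> 'q2 \<Rightarrow> (('x1 \<times> 'a1 set) \<times> 'q2) set"
  where "fibre_class m D1 D2 = (\<lambda>(s, g).
    (\<lambda>q. (level_act D1 q s, g \<otimes>\<^bsub>rat_pts D2\<^esub> inv\<^bsub>rat_pts D2\<^esub> (on_rat m q))) ` carrier (rat_pts D1))"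

definition fibre_over ::
    "('q1, 'a1, 'x1, 'q2, 'a2, 'x2) pre_shimura_morphism \<Rightarrow>
     ('q1, 'r1, 'a1, 'x1) pre_shimura_datum \<Rightarrow> 'a1 set \<Rightarrow>
     ('q2, 'r2, 'a2, 'x2) pre_shimura_datum \<Rightarrow> 'a2 set \<Rightarrow>
     'x2 \<times> 'a2 set \<Rightarrow> (('x1 \<times> 'a1 set) \<times> 'q2) set topology"
  where "fibre_over m D1 K1 D2 K2 t =
    quotient_topology (fibre_objects m D1 K1 D2 K2 t) (fibre_class m D1 D2)"

definition fibre_to_Sh ::
    "('q1, 'r1, 'a1, 'x1) pre_shimura_datum \<Rightarrow>
     (('x1 \<times> 'a1 set) \<times> 'q2) set \<Rightarrow> ('x1 \<times> 'a1 set) set"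
  where "fibre_to_Sh D1 c = fst ` c"


section \<open>The pair of \<open>GL\<^sub>2\<close> and the real projective line\<close>

definition GL2 :: "('r::comm_ring_1 ^ 2 ^ 2) monoid"
  where "GL2 = \<lparr>carrier = {A. invertible A}, mult = (**), one = mat 1\<rparr>"

lemma group_GL2: "group (GL2 :: ('r::comm_ring_1 ^ 2 ^ 2) monoid)"
proof (rule groupI)
  fix A :: "'r ^ 2 ^ 2" assume "A \<in> carrier GL2"
  then obtain B where "A ** B = mat 1" "B ** A = mat 1"
    by (auto simp: GL2_def invertible_def)
  thus "\<exists>B\<in>carrier GL2. B \<otimes>\<^bsub>GL2\<^esub> A = \<one>\<^bsub>GL2\<^esub>"
    by (auto simp: GL2_def invertible_def)
qed (auto simp: GL2_def invertible_mult matrix_mul_assoc invertible_def[of "mat 1"])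

definition P1_real :: "(real ^ 2) set topology"
  where "P1_real = quotient_topology (top_of_set (UNIV - {0})) (\<lambda>v. span {v})"

lemma topspace_P1_real: "topspace P1_real = {F. subspace F \<and> dim F = 1}"
proof (intro equalityI subsetI)
  fix F assume "F \<in> topspace P1_real"
  then obtain v :: "real ^ 2" where "v \<noteq> 0" "F = span {v}"
    by (auto simp: P1_real_def)
  thus "F \<in> {F. subspace F \<and> dim F = 1}"
    by (simp add: dim_eq_card_independent)
next
  fix F :: "(real ^ 2) set" assume "F \<in> {F. subspace F \<and> dim F = 1}"
  then obtain B where F: "subspace F" "B \<subseteq> F" "independent B" "F \<subseteq> span B" "card B = 1"
    using basis_exists[of F] by auto
  then obtain v where B: "B = {v}"
    by (auto simp: card_1_singleton_iff)
  hence "F = span {v}" "v \<noteq> 0"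
    using F span_minimal[of B F] by (auto simp: dependent_single)
  thus "F \<in> topspace P1_real"
    by (auto simp: P1_real_def)
qed

definition GL2_datum ::
    "(rat ^ 2 ^ 2, real ^ 2 ^ 2, fin_adele ^ 2 ^ 2, (real ^ 2) set) pre_shimura_datum"
  where "GL2_datum =
    \<lparr>rat_pts = GL2, real_pts = GL2, adele_pts = GL2,
     to_real = map_matrix of_rat, to_adele = map_matrix rat_to_adele,
     sym_space = P1_real, action = (\<lambda>A F. (*v) A ` F)\<rparr>"

definition GL2_zhat :: "(fin_adele ^ 2 ^ 2) set"
  where "GL2_zhat = map_matrix zhat_to_adele ` carrier GL2"

text \<open>
  Orbits of \<open>GL\<^sub>2(Z)\<close> on lines; since \<open>-1\<close> acts trivially they are also the orbits of \<open>PGL\<^sub>2(Z)\<close>.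
\<close>

definition PGL2_int_orbit :: "(real ^ 2) set \<Rightarrow> (real ^ 2) set set"
  where "PGL2_int_orbit F =
    (\<lambda>A :: int ^ 2 ^ 2. (*v) (map_matrix of_int A) ` F) ` carrier GL2"


section \<open>The affine group and the quotient of its conjugacy class\<close>

type_synonym 'r aff_pts = "('r ^ 2) \<times> ('r ^ 2 ^ 2)"

definition aff_GL2 :: "'r::comm_ring_1 aff_pts monoid"
  where "aff_GL2 =
    \<lparr>carrier = UNIV \<times> {A. invertible A},
     mult = (\<lambda>(v, A) (w, B). (v + A *v w, A ** B)),
     one = (0, mat 1)\<rparr>"

lemma group_aff_GL2: "group (aff_GL2 :: 'r::comm_ring_1 aff_pts monoid)"
proof (rule groupI)
  fix g :: "'r aff_pts" assume "g \<in> carrier aff_GL2"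
  then obtain v A B where g: "g = (v, A)" and AB: "A ** B = mat 1" "B ** A = mat 1"
    by (auto simp: aff_GL2_def invertible_def)
  have "(- (B *v v), B) \<in> carrier aff_GL2"
    using AB by (auto simp: aff_GL2_def invertible_def)
  moreover have "(- (B *v v), B) \<otimes>\<^bsub>aff_GL2\<^esub> g = \<one>\<^bsub>aff_GL2\<^esub>"
    using AB by (simp add: aff_GL2_def g)
  ultimately show "\<exists>h\<in>carrier aff_GL2. h \<otimes>\<^bsub>aff_GL2\<^esub> g = \<one>\<^bsub>aff_GL2\<^esub>"
    by blast
qed (auto simp: aff_GL2_def invertible_mult matrix_mul_assoc matrix_vector_mul_assoc
       matrix_vector_right_distrib add.assoc invertible_def[of "mat 1"])

definition map_aff :: "('r \<Rightarrow> 's) \<Rightarrow> 'r aff_pts \<Rightarrow> 's aff_pts"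
  where "map_aff f = (\<lambda>(v, A). (\<chi> i. f (v $ i), map_matrix f A))"

definition aff_zhat :: "fin_adele aff_pts set"
  where "aff_zhat = map_aff zhat_to_adele ` carrier aff_GL2"

definition aff_matrix :: "real aff_pts \<Rightarrow> real ^ 3 ^ 3"
  where "aff_matrix = (\<lambda>(v, A).
    vector [vector [A $ 1 $ 1, A $ 1 $ 2, v $ 1],
            vector [A $ 2 $ 1, A $ 2 $ 2, v $ 2],
            vector [0, 0, 1]])"

text \<open>
  A homomorphism from the square of the real multiplicative group to \<open>P\<close> is represented by its
  (Zariski dense) effect on real points.
\<close>

type_synonym aff_cochar = "real \<times> real \<Rightarrow> real aff_pts"

definition torus_pts :: "(real \<times> real) set"
  where "torus_pts = (UNIV - {0}) \<times> (UNIV - {0})"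

definition h0 :: aff_cochar
  where "h0 = (\<lambda>(x, y) \<in> torus_pts. (0, vector [vector [x * y, 0], vector [0, 1]]))"

definition conj_cochar :: "real aff_pts \<Rightarrow> aff_cochar \<Rightarrow> aff_cochar"
  where "conj_cochar g h =
    (\<lambda>t \<in> torus_pts. g \<otimes>\<^bsub>aff_GL2\<^esub> h t \<otimes>\<^bsub>aff_GL2\<^esub> inv\<^bsub>aff_GL2\<^esub> g)"

text \<open>
  The conjugacy class, topologised as a homogeneous space of \<open>P(R)\<close>.
\<close>

definition Y_P :: "aff_cochar topology"
  where "Y_P = quotient_topology (top_of_set (carrier aff_GL2)) (\<lambda>g. conj_cochar g h0)"

definition F0_space :: "aff_cochar \<Rightarrow> (real ^ 3) set"
  where "F0_space h = {v. \<forall>t\<in>torus_pts. aff_matrix (h t) *v v = v}"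

definition Y_P_class :: "aff_cochar \<Rightarrow> aff_cochar set"
  where "Y_P_class h = {h' \<in> topspace Y_P. F0_space h' = F0_space h}"

definition Y_P_bar :: "aff_cochar set topology"
  where "Y_P_bar = quotient_topology Y_P Y_P_class"

definition aff_datum ::
    "(rat aff_pts, real aff_pts, fin_adele aff_pts,
      aff_cochar set) pre_shimura_datum"
  where "aff_datum =
    \<lparr>rat_pts = aff_GL2, real_pts = aff_GL2, adele_pts = aff_GL2,
     to_real = map_aff of_rat, to_adele = map_aff rat_to_adele,
     sym_space = Y_P_bar, action = (\<lambda>g c. conj_cochar g ` c)\<rparr>"

text \<open>
  The composite \<open>Y_P \<rightarrow> X' \<rightarrow> P\<^sup>1(R)\<close>: the line on which the \<open>GL\<^sub>2\<close>-component of \<open>h\<close> is trivial.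
\<close>

definition F0_line :: "aff_cochar \<Rightarrow> (real ^ 2) set"
  where "F0_line h = {v. \<forall>t\<in>torus_pts. snd (h t) *v v = v}"

definition aff_proj ::
    "(rat aff_pts, fin_adele aff_pts, aff_cochar set,
      rat ^ 2 ^ 2, fin_adele ^ 2 ^ 2, (real ^ 2) set) pre_shimura_morphism"
  where "aff_proj =
    \<lparr>on_rat = snd, on_adele = snd, on_space = (\<lambda>c. the_elem (F0_line ` c))\<rparr>"

text \<open>
  The point of the quotient of \<open>Y_P\<close> with line \<open>F\<close> and translation part \<open>v\<close> modulo \<open>F\<close>.
\<close>

definition Y_P_point :: "(real ^ 2) set \<Rightarrow> real ^ 2 \<Rightarrow> aff_cochar set"
  where "Y_P_point F v =
    {h \<in> topspace Y_P. F0_line h = F \<and> vector [v $ 1, v $ 2, 1] \<in> F0_space h}"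


section \<open>Pre-lilacs\<close>

text \<open>
  A free module \<open>M\<close> of rank two is given inside \<open>M\<^sub>R\<close>, which is a real vector space of dimension two
  in which a basis of \<open>M\<close> is a real basis; its topology does not depend on the Euclidean structure.
\<close>

definition pre_lilac :: "'w::euclidean_space set \<Rightarrow> 'w set \<Rightarrow> bool"
  where "pre_lilac M F \<longleftrightarrow>
    (\<exists>b1 b2. b1 \<noteq> b2 \<and> independent {b1, b2} \<and> span {b1, b2} = UNIV \<and>
       M = {of_int m *\<^sub>R b1 + of_int n *\<^sub>R b2 | m n. True}) \<and>
    subspace F \<and> dim F = 1"

definition marking :: "(real ^ 2 \<Rightarrow> 'w::euclidean_space) \<Rightarrow> 'w set \<Rightarrow> bool"
  where "marking \<phi> M \<longleftrightarrow> linear \<phi> \<and> bij \<phi> \<and> \<phi> ` {v. \<forall>i. v $ i \<in> \<int>} = M"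

definition lilac_aut :: "'w::euclidean_space set \<Rightarrow> 'w set \<Rightarrow> ('w \<Rightarrow> 'w) set"
  where "lilac_aut M F = {\<alpha>. linear \<alpha> \<and> bij \<alpha> \<and> \<alpha> ` M = M \<and> \<alpha> ` F = F}"

text \<open>
  The leaf through \<open>v\<close>, as a double coset for \<open>M\<close> and \<open>F\<close>.
\<close>

definition leaf :: "'w::euclidean_space set \<Rightarrow> 'w set \<Rightarrow> 'w \<Rightarrow> 'w set"
  where "leaf M F v = {m + v + f | m f. m \<in> M \<and> f \<in> F}"

definition leaf_space :: "'w::euclidean_space set \<Rightarrow> 'w set \<Rightarrow> 'w set topology"
  where "leaf_space M F = quotient_topology euclidean (leaf M F)"

end

theory Submission
  imports Defs
begin

text \<open>
  Every invertible adelic matrix is the product of a rational and a profinite integral one, so the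
  base is the orbit space of \<open>GL\<^sub>2(Q) \<inter> GL\<^sub>2(Zhat) = GL\<^sub>2(Z)\<close> on lines. An object of the fibre over
  \<open>(F\<^sub>0, GL\<^sub>2(Zhat))\<close> carries a rational matrix identifying its linear part with the base object, and
  every finite adele is the sum of a rational number and a profinite integer; hence each object
  can be moved by \<open>P(Q)\<close> to one whose coset is trivial and whose
  identification with the base object is the identity. Such an object is a point of the quotient of
  \<open>Y_P\<close> with line \<open>F\<^sub>0\<close>, that is a vector of \<open>R\<^sup>2\<close> modulo \<open>F\<^sub>0\<close>, and what is left of \<open>P(Q)\<close> is the group of
  translations by \<open>Q\<^sup>2 \<inter> Zhat\<^sup>2 = Z\<^sup>2\<close>. Sending an object to its normal form and a vector to its
  object are continuous maps that are inverse to each other on equivalence classes, so they induce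
  homeomorphisms of the quotients. Forgetting the identification enlarges the group of translations
  by the stabiliser of \<open>F\<^sub>0\<close> in \<open>GL\<^sub>2(Z)\<close>, which is the automorphism group of the pre-lilac.
\<close>

section \<open>Arithmetic of the finite adeles\<close>

text \<open>The space of leaves is usually not Hausdorff: for a line of irrational slope every leaf
  is dense in the torus and the quotient topology is indiscrete. Hence no compactness or separation
  argument can produce the homeomorphism. All continuity is established before passing to quotients,
  on \<open>R^2\<close>, on \<open>P(R)\<close> and on discrete coset spaces, by maps in both
  directions that need to be inverse only up to equivalence.

  The identification carried by an object of the fibre cannot be dropped. The matrix
  \<open>-1\<close> lies in \<open>GL2(Z)\<close> and fixes every line, so in the plain subset of
  \<open>Sh\<close> the leaves through \<open>v\<close> and \<open>-v\<close> always coincide,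
  whatever the pre-lilac.

  Reduction still works because an invertible adelic matrix, once its denominators are cleared,
  divides a nonzero integer scalar: the ideals that occur contain a nonzero integer and are
  generated by ordinary gcds.\<close>

lemma adele_fract_eq_iff:
  "n \<noteq> 0 \<Longrightarrow> m \<noteq> 0 \<Longrightarrow> adele_fract a n = adele_fract b m \<longleftrightarrow> a * of_int m = b * of_int n"
  including fin_adele.lifting by transfer (simp add: fin_adele_rel_def)

lemma adele_fract_add:
  "n \<noteq> 0 \<Longrightarrow> m \<noteq> 0 \<Longrightarrow>
    adele_fract a n + adele_fract b m = adele_fract (a * of_int m + b * of_int n) (n * m)"
  including fin_adele.lifting by transfer (simp add: fin_adele_rel_def)

lemma adele_fract_mult:
  "n \<noteq> 0 \<Longrightarrow> m \<noteq> 0 \<Longrightarrow> adele_fract a n * adele_fract b m = adele_fract (a * b) (n * m)"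
  including fin_adele.lifting by transfer (simp add: fin_adele_rel_def)

lemma adele_fract_0_1: "adele_fract 0 1 = 0" "adele_fract 1 1 = 1"
  including fin_adele.lifting by (transfer; simp add: fin_adele_rel_def)+

lemma adele_fract_surj: "\<exists>a n. n \<noteq> 0 \<and> x = adele_fract a n"
  including fin_adele.lifting
proof transfer
  fix x :: "zhat \<times> int" assume "fin_adele_rel x x"
  thus "\<exists>a n. n \<noteq> 0 \<and> fin_adele_rel x (if n = 0 then (0, 1) else (a, n))"
    by (intro exI[of _ "fst x"] exI[of _ "snd x"]) (simp add: fin_adele_rel_def)
qed

text \<open>Serves all six coefficient maps between Z, Q, R, Zhat and the finite adeles; each of
  them then acts entrywise on the points of both groups.\<close>

locale comm_ring_morphism =
  fixes f :: "'a::comm_ring_1 \<Rightarrow> 'b::comm_ring_1"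
  assumes hom_0 [simp]: "f 0 = 0"
    and hom_1 [simp]: "f 1 = 1"
    and hom_add: "f (x + y) = f x + f y"
    and hom_mult: "f (x * y) = f x * f y"
begin

lemma hom_uminus: "f (- x) = - f x"
  using hom_add[of "- x" x] by (simp add: eq_neg_iff_add_eq_0)

lemma hom_diff: "f (x - y) = f x - f y"
  using hom_add[of x "- y"] by (simp add: hom_uminus)

lemma hom_sum: "f (sum g A) = (\<Sum>x\<in>A. f (g x))"
  by (induction A rule: infinite_finite_induct) (auto simp: hom_add)

lemma hom_of_nat: "f (of_nat k) = of_nat k"
  by (induction k) (auto simp: hom_add)

lemma hom_of_int: "f (of_int k) = of_int k"
  by (cases k rule: int_cases2) (auto simp: hom_of_nat hom_uminus)

lemma map_matrix_mult: "map_matrix f (A ** B) = map_matrix f A ** map_matrix f B"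
  by (simp add: vec_eq_iff matrix_matrix_mult_def hom_sum hom_mult)

lemma map_matrix_one: "map_matrix f (mat 1) = mat 1"
  by (simp add: vec_eq_iff mat_def)

lemma map_matrix_vector_mult:
  "(\<chi> i. f ((A *v v) $ i)) = map_matrix f A *v (\<chi> i. f (v $ i))"
  by (simp add: vec_eq_iff matrix_vector_mult_def hom_sum hom_mult)

lemma invertible_map_matrix: "invertible A \<Longrightarrow> invertible (map_matrix f A)"
  unfolding invertible_def by (metis map_matrix_mult map_matrix_one)

lemma map_matrix_hom: "map_matrix f \<in> hom GL2 GL2"
  by (auto simp: hom_def GL2_def map_matrix_mult invertible_map_matrix)

lemma map_aff_hom: "map_aff f \<in> hom aff_GL2 aff_GL2"
  by (auto simp: hom_def aff_GL2_def map_aff_def map_matrix_mult invertible_map_matrix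
      vec_eq_iff hom_add simp flip: map_matrix_vector_mult)

lemma subgroup_map_matrix: "subgroup (map_matrix f ` carrier GL2) GL2"
  by (intro group_hom.img_is_subgroup group_hom.intro group_GL2 group_hom_axioms.intro map_matrix_hom)

lemma subgroup_map_aff: "subgroup (map_aff f ` carrier aff_GL2) aff_GL2"
  by (intro group_hom.img_is_subgroup group_hom.intro group_aff_GL2 group_hom_axioms.intro map_aff_hom)

end

section \<open>The embeddings of Zhat and Q into the finite adeles\<close>

interpretation zhat_to_adele: comm_ring_morphism zhat_to_adele
  by unfold_locales (auto simp: zhat_to_adele_def adele_fract_0_1 adele_fract_add adele_fract_mult)

lemma zhat_to_adele_eq_iff: "zhat_to_adele a = zhat_to_adele b \<longleftrightarrow> a = b"
  by (simp add: zhat_to_adele_def adele_fract_eq_iff)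

lemma of_int_mult_adele_fract: "n \<noteq> 0 \<Longrightarrow> of_int n * adele_fract a n = zhat_to_adele a"
  unfolding zhat_to_adele.hom_of_int[symmetric] unfolding zhat_to_adele_def
  by (simp add: adele_fract_mult adele_fract_eq_iff)

lemma adele_denominator:
  fixes x :: fin_adele
  obtains n a where "n > 0" "of_int n * x = zhat_to_adele a"
proof -
  obtain a n where "n \<noteq> 0" "x = adele_fract a n"
    using adele_fract_surj by blast
  hence "of_int \<bar>n\<bar> * x = zhat_to_adele (of_int (sgn n) * a)" "\<bar>n\<bar> > 0"
    using of_int_mult_adele_fract[of n a]
    by (auto simp: zhat_to_adele.hom_mult zhat_to_adele.hom_of_int sgn_if)
  thus ?thesis using that by blast
qed

text \<open>Nonzero integers are units of the finite adeles, with inverse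
  \<open>adele_fract 1 n\<close>, so they cancel in spite of the zero divisors.\<close>

lemma adele_of_int_cancel:
  assumes "of_int n * x = (of_int n * y :: fin_adele)" "n \<noteq> 0"
  shows "x = y"
proof -
  have "adele_fract 1 n * of_int n = 1"
    using of_int_mult_adele_fract[of n 1] assms(2) by (simp add: mult.commute)
  with arg_cong[OF assms(1), of "\<lambda>z. adele_fract 1 n * z"] show ?thesis
    by (simp flip: mult.assoc)
qed

text \<open>\<open>rat_to_adele\<close> is defined through the reduced fraction. Admitting an
  arbitrary fraction \<open>p / n\<close> here spares later proofs any reasoning about
  \<open>quotient_of\<close>.\<close>

lemma of_int_mult_rat_to_adele:
  assumes "of_int n * q = of_int p"
  shows "of_int n * rat_to_adele q = of_int p"
proof -
  obtain a b where ab: "quotient_of q = (a, b)" by fastforce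
  have b: "b > 0" "q = of_int a / of_int b"
    using quotient_of_denom_pos[OF ab] quotient_of_div[OF ab] by auto
  have "(of_int (n * a) :: rat) = of_int (p * b)"
    using assms b by (simp add: field_simps)
  hence eq: "n * a = p * b" by (simp only: of_int_eq_iff)
  have "rat_to_adele q = adele_fract (of_int a) b"
    by (simp add: rat_to_adele_def ab)
  hence "of_int b * rat_to_adele q = of_int a"
    using of_int_mult_adele_fract[of b "of_int a"] b(1) by (simp add: zhat_to_adele.hom_of_int)
  hence "of_int b * (of_int n * rat_to_adele q) = of_int (n * a)"
    by (simp add: mult.left_commute[of "of_int b"])
  also have "\<dots> = of_int b * of_int p"
    by (simp add: eq)
  finally show ?thesis
    using b(1) by (auto dest: adele_of_int_cancel)
qed

lemma rat_denominator:
  fixes q :: rat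
  obtains n p where "n \<noteq> 0" "of_int n * q = of_int p" "of_int n * rat_to_adele q = of_int p"
proof -
  obtain a b where ab: "quotient_of q = (a, b)" by fastforce
  have "b > 0" "q = of_int a / of_int b"
    using quotient_of_denom_pos[OF ab] quotient_of_div[OF ab] by auto
  thus ?thesis
    using that[of b a] of_int_mult_rat_to_adele[of b q a] by auto
qed

interpretation rat_to_adele: comm_ring_morphism rat_to_adele
proof
  show "rat_to_adele 0 = 0" "rat_to_adele 1 = 1"
    using of_int_mult_rat_to_adele[of 1 _ 0] of_int_mult_rat_to_adele[of 1 _ 1] by auto
  fix x y
  obtain n a where x: "n \<noteq> 0" "of_int n * x = of_int a" "of_int n * rat_to_adele x = of_int a"
    by (rule rat_denominator)
  obtain m b where y: "m \<noteq> 0" "of_int m * y = of_int b" "of_int m * rat_to_adele y = of_int b"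
    by (rule rat_denominator)
  have "of_int (n * m) * (x + y) = of_int m * (of_int n * x) + of_int n * (of_int m * y)"
    by (simp add: algebra_simps)
  hence "of_int (n * m) * (x + y) = of_int (m * a + n * b)"
    by (simp add: x y)
  hence "of_int (n * m) * rat_to_adele (x + y) = of_int (m * a + n * b)"
    by (rule of_int_mult_rat_to_adele)
  also have "\<dots> = of_int m * (of_int n * rat_to_adele x) + of_int n * (of_int m * rat_to_adele y)"
    by (simp add: x y)
  also have "\<dots> = of_int (n * m) * (rat_to_adele x + rat_to_adele y)"
    by (simp add: algebra_simps)
  finally show "rat_to_adele (x + y) = rat_to_adele x + rat_to_adele y"
    by (rule adele_of_int_cancel) (simp add: x y)
  have "of_int (n * m) * (x * y) = (of_int n * x) * (of_int m * y)"
    by (simp add: algebra_simps)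
  hence "of_int (n * m) * (x * y) = of_int (a * b)"
    by (simp add: x y)
  hence "of_int (n * m) * rat_to_adele (x * y) = of_int (a * b)"
    by (rule of_int_mult_rat_to_adele)
  also have "\<dots> = (of_int n * rat_to_adele x) * (of_int m * rat_to_adele y)"
    by (simp add: x y)
  also have "\<dots> = of_int (n * m) * (rat_to_adele x * rat_to_adele y)"
    by (simp add: algebra_simps)
  finally show "rat_to_adele (x * y) = rat_to_adele x * rat_to_adele y"
    by (rule adele_of_int_cancel) (simp add: x y)
qed

interpretation rat_to_real: comm_ring_morphism "of_rat :: rat \<Rightarrow> real"
  by unfold_locales (auto simp: of_rat_add of_rat_mult)

interpretation int_to_rat: comm_ring_morphism "of_int :: int \<Rightarrow> rat"
  by unfold_locales auto

interpretation int_to_real: comm_ring_morphism "of_int :: int \<Rightarrow> real"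
  by unfold_locales auto

interpretation int_to_zhat: comm_ring_morphism "of_int :: int \<Rightarrow> zhat"
  by unfold_locales auto

section \<open>Approximation of profinite integers by integers and of adeles by rationals\<close>

text \<open>Dividing by \<open>n\<close> costs a factor \<open>n\<close> of the modulus, so the
  component modulo \<open>k\<close> of the quotient is read off from the component of
  \<open>a\<close> modulo \<open>n * k\<close>.\<close>

lemma zhat_dvd_residue:
  assumes "n > 0"
  shows "\<exists>b. a = of_int (residue a n) + of_int (int n) * b"
proof -
  define g where "g = (\<lambda>k. if k = 0 then 0 else ((residue a (n * k) - residue a n) div int n))"
  have dv: "int n * g k = residue a (n * k) - residue a n" if "k > 0" for k
  proof -
    have "residue a (n * k) mod int n = residue a n mod int n"
      using residue_dvd[of "n * k" n a] assms that by simp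
    hence "int n dvd residue a (n * k) - residue a n"
      by (simp only: mod_eq_dvd_iff)
    thus ?thesis using that by (simp add: g_def)
  qed
  \<comment> \<open>Reduction modulo \<open>k\<close> gives the representative that the type
    demands; \<open>g 0 = 0\<close> was chosen to match the normalisation at index 0.\<close>
  define h where "h = (\<lambda>k. g k mod int k)"
  have "h k mod int m = h m" if "k > 0" "m dvd k" for m k
  proof -
    have m: "m > 0" using that by (auto intro: Nat.gr0I)
    have "residue a (n * k) mod int (n * m) = residue a (n * m) mod int (n * m)"
      using residue_dvd[of "n * k" "n * m" a] residue_mod[of a "n * m"] that assms
      by (simp del: of_nat_mult residue_mod)
    hence "int (n * m) dvd int n * g k - int n * g m"
      using that m by (simp add: dv mod_eq_dvd_iff)
    hence "int m dvd g k - g m"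
      using assms by (simp flip: right_diff_distrib)
    hence "g k mod int m = g m mod int m"
      by (simp add: mod_eq_dvd_iff)
    thus ?thesis
      using that by (simp add: h_def mod_mod_cancel)
  qed
  hence h: "h \<in> {f. f 0 = 0 \<and> (\<forall>m n. n > 0 \<longrightarrow> m dvd n \<longrightarrow> f n mod int m = f m)}"
    by (auto simp: h_def g_def)
  have "residue a k = residue (of_int (residue a n) + of_int (int n) * Abs_zhat h) k" for k
  proof (cases "k = 0")
    case False
    have "residue a n + int n * h k = residue a n + int n * g k + int n * (h k - g k)"
      by (simp add: algebra_simps)
    also have "\<dots> = residue a (n * k) + int n * (h k - g k)"
      using False by (simp add: dv)
    finally have "(residue a n + int n * h k) mod int k =
        (residue a (n * k) + int n * (h k - g k)) mod int k"
      by simp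
    also have "\<dots> = residue a (n * k) mod int k"
    proof -
      have "int k dvd int n * (h k - g k)"
        unfolding h_def by (simp flip: mod_eq_dvd_iff)
      thus ?thesis by (metis add.right_neutral mod_add_right_eq dvd_imp_mod_0)
    qed
    also have "\<dots> = residue a k"
      using False assms residue_dvd[of "n * k" k a] by simp
    finally have "(residue a n + int n mod int k * h k) mod int k = residue a k"
      by (metis mod_add_right_eq mod_mult_left_eq)
    thus ?thesis
      using False Abs_zhat_inverse[OF h]
      by (simp add: plus_zhat.rep_eq residue_times residue_of_nat residue_of_int mod_simps)
  qed simp
  hence "a = of_int (residue a n) + of_int (int n) * Abs_zhat h"
    by (rule zhat_eqI)
  thus ?thesis by blast
qed

lemma zhat_cong_int:
  fixes a :: zhat
  assumes "n \<noteq> 0"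
  obtains k b where "a = of_int k + of_int n * b"
proof -
  have "int (nat \<bar>n\<bar>) = \<bar>n\<bar>" "nat \<bar>n\<bar> > 0"
    using assms by auto
  with zhat_dvd_residue[of "nat \<bar>n\<bar>" a]
  obtain b where "a = of_int (residue a (nat \<bar>n\<bar>)) + of_int \<bar>n\<bar> * b"
    by metis
  also have "of_int \<bar>n\<bar> * b = of_int n * (of_int (sgn n) * b)"
    by (auto simp: abs_if sgn_if)
  finally show ?thesis using that by blast
qed

text \<open>Inside the finite adeles Q and Zhat meet in Z: reducing \<open>n * a = p\<close> modulo
  \<open>n\<close> shows that the denominator divides the numerator.\<close>

lemma rat_to_adele_eq_zhat_to_adele:
  assumes "rat_to_adele q = zhat_to_adele a"
  shows "q \<in> \<int>"
proof -
  obtain n p where n: "n \<noteq> 0" "of_int n * q = of_int p" "of_int n * rat_to_adele q = of_int p"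
    by (rule rat_denominator)
  hence "zhat_to_adele (of_int n * a) = zhat_to_adele (of_int p)"
    using assms by (simp add: zhat_to_adele.hom_mult zhat_to_adele.hom_of_int)
  hence "of_int n * a = of_int p"
    by (simp add: zhat_to_adele_eq_iff)
  hence "residue (of_int n * a) (nat \<bar>n\<bar>) = residue (of_int p) (nat \<bar>n\<bar>)"
    by simp
  hence "p mod \<bar>n\<bar> = 0"
    using n(1) by (simp add: residue_times residue_of_int mod_simps)
  then obtain d where "p = n * d" by (auto simp: mod_eq_0_iff_dvd)
  hence "q = of_int d" using n by simp
  thus ?thesis by simp
qed

text \<open>For \<open>x = a / n\<close>, an integer \<open>k\<close> congruent to \<open>a\<close>
  modulo \<open>n\<close> splits \<open>x\<close> into \<open>k / n\<close> and a profinite integer.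
  This is the additive counterpart of class number one.\<close>

lemma adele_rat_plus_zhat: "\<exists>q a. x = rat_to_adele q + zhat_to_adele a"
proof -
  obtain n a where n: "n > 0" "of_int n * x = zhat_to_adele a"
    by (rule adele_denominator)
  obtain k b where a: "a = of_int k + of_int n * b"
    using zhat_cong_int[of n a] n(1) by blast
  have "of_int n * x = of_int n * (rat_to_adele (of_int k / of_int n) + zhat_to_adele b)"
    using n of_int_mult_rat_to_adele[of n "of_int k / of_int n" k]
    by (simp add: a zhat_to_adele.hom_add zhat_to_adele.hom_mult zhat_to_adele.hom_of_int
        distrib_left)
  thus ?thesis
    using n(1) adele_of_int_cancel[of n x] by blast
qed

text \<open>An ideal of Zhat that contains a nonzero integer \<open>N\<close> is determined modulo
  \<open>N\<close>, so it has an integer generator: the gcd of \<open>N\<close> and of integers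
  congruent to \<open>a\<close> and \<open>b\<close>. Cancelling \<open>g\<close>, which is
  legitimate because Zhat is torsion-free, makes the cofactors coprime.\<close>

lemma zhat_principal_ideal:
  fixes a b u v :: zhat
  assumes "a * u + b * v = of_int N" "N \<noteq> 0"
  obtains g x y a' b' where "g \<noteq> 0" "a = of_int g * a'" "b = of_int g * b'" "a * x + b * y = of_int g"
    "a' * x + b' * y = 1"
proof -
  obtain k c where a: "a = of_int k + of_int N * c" using zhat_cong_int assms(2) by blast
  obtain l d where b: "b = of_int l + of_int N * d" using zhat_cong_int assms(2) by blast
  define g where "g = gcd (gcd k l) N"
  have g0: "g \<noteq> 0" using assms(2) by (simp add: g_def)
  have "g dvd k" "g dvd l" "g dvd N"
    by (auto simp: g_def intro: dvd_trans[OF gcd_dvd1])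
  then obtain k' l' N' where k: "k = g * k'" "l = g * l'" "N = g * N'"
    by (auto elim!: dvdE)
  obtain s t where st: "s * k + t * l = gcd k l"
    using bezout_int by blast
  obtain w r where wr: "w * gcd k l + r * N = g"
    unfolding g_def using bezout_int by blast
  have "g = (w * s) * k + (w * t) * l + r * N"
    using st wr by (metis distrib_left mult.assoc)
  hence g: "(of_int g :: zhat) = of_int (w * s) * of_int k + of_int (w * t) * of_int l + of_int r * of_int N"
    by (simp flip: of_int_mult of_int_add)
  define e where "e = of_int r - c * of_int (w * s) - d * of_int (w * t)"
  define x where "x = of_int (w * s) + u * e"
  define y where "y = of_int (w * t) + v * e"
  have "a * x + b * y = a * of_int (w * s) + b * of_int (w * t) + (a * u + b * v) * e"
    by (simp add: x_def y_def algebra_simps)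
  also have "\<dots> = of_int g"
    unfolding assms(1) unfolding g unfolding a b e_def by (simp add: algebra_simps)
  finally have xy: "a * x + b * y = of_int g" .
  have a': "a = of_int g * (of_int k' + of_int N' * c)" and b': "b = of_int g * (of_int l' + of_int N' * d)"
    unfolding a b unfolding k by (simp_all add: algebra_simps)
  have "of_int g * ((of_int k' + of_int N' * c) * x + (of_int l' + of_int N' * d) * y) = of_int g * 1"
    using xy by (subst (asm) a', subst (asm) b') (simp add: algebra_simps)
  hence "(of_int k' + of_int N' * c) * x + (of_int l' + of_int N' * d) * y = 1"
    using g0 zhat_torsion_free by blast
  thus ?thesis using that[OF g0 a' b' xy] by blast
qed

section \<open>Reduction of profinite matrices and class number one\<close>

lemma invertibleI: "A ** B = mat 1 \<Longrightarrow> B ** A = mat 1 \<Longrightarrow> invertible A"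
  unfolding invertible_def by blast

lemmas mat2_simps = vec_eq_iff forall_2 sum_2 matrix_matrix_mult_def mat_def vector_2

text \<open>Column operations reduce the matrix to a lower triangular one with integral entries.\<close>

lemma zhat_matrix_integral_form:
  fixes A B :: "zhat ^ 2 ^ 2"
  assumes AB: "A ** B = mat (of_int N)" and N: "N \<noteq> 0"
  obtains U and C :: "int ^ 2 ^ 2" where "invertible U" "A ** U = map_matrix of_int C"
proof -
  have "A$1$1 * B$1$1 + A$1$2 * B$2$1 = of_int N"
    using AB by (simp add: mat2_simps)
  then obtain g x y a b where g: "g \<noteq> 0" "A$1$1 = of_int g * a" "A$1$2 = of_int g * b"
      "A$1$1 * x + A$1$2 * y = of_int g" "a * x + b * y = 1"
    using N by (rule zhat_principal_ideal)
  \<comment> \<open>Determinant \<open>a * x + b * y = 1\<close>; the columns of \<open>U1\<close>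
    send the first row of \<open>A\<close> to \<open>(g, 0)\<close>.\<close>
  define U1 :: "zhat ^ 2 ^ 2" where "U1 = vector [vector [x, - b], vector [y, a]]"
  define W1 :: "zhat ^ 2 ^ 2" where "W1 = vector [vector [a, b], vector [- y, x]]"
  have UW: "U1 ** W1 = mat 1" "W1 ** U1 = mat 1"
    using g(5) by (simp_all add: U1_def W1_def mat2_simps algebra_simps)
  define T where "T = A ** U1"
  \<comment> \<open>The divisibility of \<open>N\<close> by \<open>A\<close> passes to
    \<open>T\<close>. Since \<open>g\<close> is cancellable, the upper right entry of
    \<open>S\<close> vanishes, so \<open>T$2$2\<close> alone already divides
    \<open>N\<close>.\<close>
  define S where "S = W1 ** B"
  have T1: "T$1$1 = of_int g" "T$1$2 = 0"
    using g(4) by (simp_all add: T_def U1_def mat2_simps) (simp add: g(2,3) algebra_simps)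
  have "T ** S = A ** (U1 ** W1) ** B"
    by (simp add: T_def S_def matrix_mul_assoc)
  hence TS: "T ** S = mat (of_int N)"
    by (simp add: UW AB)
  hence "of_int g * S$1$2 = of_int g * 0" and TS2: "T$2$1 * S$1$2 + T$2$2 * S$2$2 = of_int N"
    using T1 by (simp_all add: mat2_simps)
  hence "S$1$2 = 0"
    using g(1) zhat_torsion_free by blast
  with TS2 have "T$2$2 * S$2$2 + 0 * 0 = of_int N" by simp
  \<comment> \<open>Bezout with second entry 0: only a unit \<open>z\<close> turning
    \<open>T$2$2\<close> into an integer is wanted. As \<open>e\<close> vanishes, \<open>f\<close>
    is the inverse of \<open>z\<close>.\<close>
  then obtain h z w f e where h: "h \<noteq> 0" "T$2$2 = of_int h * f" "0 = of_int h * e"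
      "T$2$2 * z + 0 * w = of_int h" "f * z + e * w = 1"
    using N by (rule zhat_principal_ideal)
  have "e = 0"
    using h(1,3) zhat_torsion_free[of h e 0] by simp
  define U2 :: "zhat ^ 2 ^ 2" where "U2 = vector [vector [1, 0], vector [0, z]]"
  define W2 :: "zhat ^ 2 ^ 2" where "W2 = vector [vector [1, 0], vector [0, f]]"
  have "U2 ** W2 = mat 1" "W2 ** U2 = mat 1"
    using h(5) \<open>e = 0\<close> by (simp_all add: U2_def W2_def mat2_simps algebra_simps)
  hence inv2: "invertible U2" by (rule invertibleI)
  \<comment> \<open>Modulo the diagonal entry \<open>h\<close> the remaining entry is an integer
    \<open>k\<close>; \<open>U3\<close> subtracts the \<open>m\<close>-fold of the second
    column.\<close>
  obtain k m where m: "T$2$1 = of_int k + of_int h * m"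
    using zhat_cong_int h(1) by blast
  define U3 :: "zhat ^ 2 ^ 2" where "U3 = vector [vector [1, 0], vector [- m, 1]]"
  define W3 :: "zhat ^ 2 ^ 2" where "W3 = vector [vector [1, 0], vector [m, 1]]"
  have "U3 ** W3 = mat 1" "W3 ** U3 = mat 1"
    by (simp_all add: U3_def W3_def mat2_simps)
  hence inv3: "invertible U3" by (rule invertibleI)
  have "A ** (U1 ** (U2 ** U3)) = T ** (U2 ** U3)"
    by (simp add: T_def matrix_mul_assoc)
  also have "\<dots> = map_matrix of_int (vector [vector [g, 0], vector [k, h]])"
    using T1 h(4) m by (simp add: U2_def U3_def mat2_simps algebra_simps)
  finally show ?thesis
    using that inv2 inv3 invertibleI[OF UW] by (meson invertible_mult)
qed

lemma adele_common_denominator: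
  fixes x :: "'i::finite \<Rightarrow> fin_adele"
  obtains n :: int and a where "n > 0" "\<And>i. of_int n * x i = zhat_to_adele (a i)"
proof -
  have "\<exists>n a. n > 0 \<and> of_int n * x i = zhat_to_adele a" for i
    by (rule adele_denominator[of "x i"]) blast
  then obtain d b where d: "\<And>i. d i > 0" "\<And>i. of_int (d i) * x i = zhat_to_adele (b i)"
    by metis
  have "of_int (prod d UNIV) * x i = zhat_to_adele (of_int (prod d (UNIV - {i})) * b i)" for i
  proof -
    have "prod d UNIV = prod d (UNIV - {i}) * d i"
      by (simp add: prod.remove[of UNIV i] mult.commute)
    hence "of_int (prod d UNIV) * x i = of_int (prod d (UNIV - {i})) * (of_int (d i) * x i)"
      by (simp add: mult.assoc del: of_int_prod)
    thus ?thesis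
      by (simp add: d zhat_to_adele.hom_mult zhat_to_adele.hom_of_int del: of_int_prod)
  qed
  thus ?thesis
    using that[of "prod d UNIV"] d(1) by (simp add: prod_pos)
qed

lemma matrix_common_denominator:
  fixes A :: "fin_adele ^ 2 ^ 2"
  obtains n B where "n > 0" "mat (of_int n) ** A = map_matrix zhat_to_adele B"
proof -
  obtain n :: int and a where "n > 0" "\<And>p. of_int n * (A $ fst p $ snd p) = zhat_to_adele (a p)"
    using adele_common_denominator[of "\<lambda>p :: 2 \<times> 2. A $ fst p $ snd p"] by blast
  hence "n > 0" "mat (of_int n) ** A = map_matrix zhat_to_adele (\<chi> i j. a (i, j))"
    by (simp_all add: mat2_simps) (metis fst_conv snd_conv)
  thus ?thesis using that by blast
qed

lemma zhat_map_matrix_eq_iff: "map_matrix zhat_to_adele A = map_matrix zhat_to_adele B \<longleftrightarrow> A = B"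
  by (simp add: vec_eq_iff zhat_to_adele_eq_iff)

lemma nth_mat_mult:
  fixes c :: "'r::comm_ring_1" and A :: "'r ^ 2 ^ 2"
  shows "(mat c ** A) $ i $ j = c * A $ i $ j"
  using exhaust_2[of i] by (auto simp: mat2_simps)

lemma mat_scalar_commute:
  fixes c :: "'r::comm_ring_1" and A :: "'r ^ 2 ^ 2"
  shows "mat c ** A = A ** mat c"
  by (simp add: mat2_simps mult.commute)

text \<open>A singular rational matrix has adelic determinant 0, whereas the determinant of an
  invertible matrix is a unit.\<close>

lemma invertible_rat_if_invertible_adele:
  fixes A :: "rat ^ 2 ^ 2"
  assumes "invertible (map_matrix rat_to_adele A)"
  shows "invertible A"
proof (rule ccontr)
  assume "\<not> invertible A"
  hence "det A = 0" by (simp add: invertible_det_nz)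
  moreover have "det (map_matrix rat_to_adele A) = rat_to_adele (det A)"
    by (simp add: det_2 rat_to_adele.hom_diff rat_to_adele.hom_mult)
  moreover obtain B where "map_matrix rat_to_adele A ** B = mat 1"
    using assms by (auto simp: invertible_def)
  hence "det (map_matrix rat_to_adele A) * det B = 1"
    by (metis det_mul det_I)
  ultimately show False by simp
qed

text \<open>The class number of \<open>GL\<^sub>2\<close> over the rationals is one.\<close>

lemma GL2_adele_decomposition:
  fixes A :: "fin_adele ^ 2 ^ 2"
  assumes "invertible A"
  obtains Q K where "invertible Q" "K \<in> GL2_zhat" "A = map_matrix rat_to_adele Q ** K"
proof -
  obtain A' where A': "A ** A' = mat 1"
    using assms by (auto simp: invertible_def)
  obtain n A1 where n: "n > 0" "mat (of_int n) ** A = map_matrix zhat_to_adele A1"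
    by (rule matrix_common_denominator)
  \<comment> \<open>Clearing the denominators of the inverse as well makes \<open>A1\<close> a
    divisor of the scalar \<open>n * m\<close>, which is what the column reduction requires.\<close>
  obtain m B1 where m: "m > 0" "mat (of_int m) ** A' = map_matrix zhat_to_adele B1"
    by (rule matrix_common_denominator)
  have "map_matrix zhat_to_adele (A1 ** B1) = mat (of_int n) ** A ** (mat (of_int m) ** A')"
    by (simp add: zhat_to_adele.map_matrix_mult n m)
  also have "\<dots> = mat (of_int n) ** (A ** mat (of_int m)) ** A'"
    by (simp only: matrix_mul_assoc)
  also have "\<dots> = (mat (of_int n) ** mat (of_int m)) ** (A ** A')"
    by (simp only: matrix_mul_assoc mat_scalar_commute[of "of_int m" A, symmetric])
  also have "\<dots> = map_matrix zhat_to_adele (mat (of_int (n * m)))"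
    unfolding A' matrix_mul_rid by (simp add: mat2_simps zhat_to_adele.hom_of_int zhat_to_adele.hom_mult)
  finally have "A1 ** B1 = mat (of_int (n * m))"
    by (simp only: zhat_map_matrix_eq_iff)
  moreover have "n * m \<noteq> 0" using n m by simp
  ultimately obtain U and C :: "int ^ 2 ^ 2" where U: "invertible U" "A1 ** U = map_matrix of_int C"
    by (rule zhat_matrix_integral_form)
  obtain V where V: "U ** V = mat 1" "V ** U = mat 1"
    using U(1) by (auto simp: invertible_def)
  have A1: "A1 = map_matrix of_int C ** V"
    using V U by (metis matrix_mul_assoc matrix_mul_rid)
  \<comment> \<open>From \<open>n * A = A1 = C * V\<close> the rational factor has to be
    \<open>C / n\<close>.\<close>
  define Q :: "rat ^ 2 ^ 2" where "Q = (\<chi> i j. of_int (C $ i $ j) / of_int n)"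
  have Q: "mat (of_int n) ** map_matrix rat_to_adele Q = map_matrix of_int C"
    using n(1) by (simp add: mat2_simps Q_def of_int_mult_rat_to_adele)
  have "mat (of_int n) ** A = mat (of_int n) ** map_matrix rat_to_adele Q ** map_matrix zhat_to_adele V"
    unfolding Q n A1 zhat_to_adele.map_matrix_mult
    by (simp add: vec_eq_iff matrix_matrix_mult_def zhat_to_adele.hom_of_int)
  also have "\<dots> = mat (of_int n) ** (map_matrix rat_to_adele Q ** map_matrix zhat_to_adele V)"
    by (simp add: matrix_mul_assoc)
  finally have "of_int n * A $ i $ j =
      of_int n * (map_matrix rat_to_adele Q ** map_matrix zhat_to_adele V) $ i $ j" for i j
    by (metis nth_mat_mult)
  hence A: "A = map_matrix rat_to_adele Q ** map_matrix zhat_to_adele V"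
    unfolding vec_eq_iff using n(1) adele_of_int_cancel by (metis less_irrefl)
  have "map_matrix rat_to_adele Q = A ** map_matrix zhat_to_adele U"
    unfolding A matrix_mul_assoc[symmetric] zhat_to_adele.map_matrix_mult[symmetric] V
    by (simp add: zhat_to_adele.map_matrix_one)
  hence "invertible Q"
    using assms U(1) zhat_to_adele.invertible_map_matrix
    by (metis invertible_mult invertible_rat_if_invertible_adele)
  moreover have "map_matrix zhat_to_adele V \<in> GL2_zhat"
    using V by (auto simp: GL2_zhat_def GL2_def invertible_def)
  ultimately show ?thesis using A by (rule that)
qed

section \<open>Rational points in the profinite level subgroups\<close>

lemma rat_to_adele_of_int: "rat_to_adele (of_int k) = zhat_to_adele (of_int k)"
  by (simp add: rat_to_adele.hom_of_int zhat_to_adele.hom_of_int)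

lemma rat_to_adele_matrix_eq_zhat:
  assumes "map_matrix rat_to_adele Q = map_matrix zhat_to_adele U"
  obtains Z where "Q = map_matrix of_int Z"
proof -
  have "Q $ i $ j \<in> \<int>" for i j
    using assms rat_to_adele_eq_zhat_to_adele[of "Q $ i $ j" "U $ i $ j"] by (simp add: vec_eq_iff)
  then obtain z where "\<And>i j. Q $ i $ j = of_int (z i j)"
    unfolding Ints_def image_iff by metis
  hence "Q = map_matrix of_int (\<chi> i j. z i j)"
    by (simp add: vec_eq_iff)
  thus ?thesis by (rule that)
qed

text \<open>Integral entries alone would not give an element of \<open>GL2(Z)\<close>. The adelic
  image of the inverse of \<open>Q\<close> is the inverse of the profinite matrix, so the entries of
  the inverse are integers too.\<close>

lemma rat_matrix_in_GL2_zhat_iff: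
  assumes "invertible Q"
  shows "map_matrix rat_to_adele Q \<in> GL2_zhat \<longleftrightarrow> Q \<in> map_matrix of_int ` carrier GL2"
proof
  assume "map_matrix rat_to_adele Q \<in> GL2_zhat"
  then obtain U V where UV: "map_matrix rat_to_adele Q = map_matrix zhat_to_adele U"
      "U ** V = mat 1" "V ** U = mat 1"
    by (auto simp: GL2_zhat_def GL2_def invertible_def)
  obtain R where R: "Q ** R = mat 1" "R ** Q = mat 1"
    using assms by (auto simp: invertible_def)
  have "map_matrix rat_to_adele R = map_matrix rat_to_adele R **
      (map_matrix zhat_to_adele U ** map_matrix zhat_to_adele V)"
    by (simp add: UV flip: zhat_to_adele.map_matrix_mult)
      (simp add: zhat_to_adele.map_matrix_one)
  also have "\<dots> = map_matrix rat_to_adele (R ** Q) ** map_matrix zhat_to_adele V"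
    by (simp add: rat_to_adele.map_matrix_mult UV matrix_mul_assoc)
  finally have "map_matrix rat_to_adele R = map_matrix zhat_to_adele V"
    by (simp add: R rat_to_adele.map_matrix_one)
  then obtain Y where Y: "R = map_matrix of_int Y"
    by (rule rat_to_adele_matrix_eq_zhat)
  obtain Z where Z: "Q = map_matrix of_int Z"
    using UV(1) by (rule rat_to_adele_matrix_eq_zhat)
  have "map_matrix rat_of_int (Z ** Y) = map_matrix rat_of_int (mat 1)"
       "map_matrix rat_of_int (Y ** Z) = map_matrix rat_of_int (mat 1)"
    using R by (simp_all add: Y Z int_to_rat.map_matrix_mult int_to_rat.map_matrix_one)
  hence "Z ** Y = mat 1" "Y ** Z = mat 1"
    by (simp_all add: vec_eq_iff)
  thus "Q \<in> map_matrix of_int ` carrier GL2"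
    using Z by (auto simp: GL2_def invertible_def)
next
  assume "Q \<in> map_matrix of_int ` carrier GL2"
  then obtain Z where Z: "invertible Z" "Q = map_matrix of_int Z"
    by (auto simp: GL2_def)
  have "map_matrix rat_to_adele Q = map_matrix zhat_to_adele (map_matrix of_int Z)"
    by (simp add: Z vec_eq_iff rat_to_adele_of_int)
  thus "map_matrix rat_to_adele Q \<in> GL2_zhat"
    using int_to_zhat.invertible_map_matrix[OF Z(1)] by (auto simp: GL2_zhat_def GL2_def)
qed

lemma mem_aff_zhat_iff:
  "(v, A) \<in> aff_zhat \<longleftrightarrow> (\<forall>i. v $ i \<in> range zhat_to_adele) \<and> A \<in> GL2_zhat"
proof
  assume r: "(\<forall>i. v $ i \<in> range zhat_to_adele) \<and> A \<in> GL2_zhat"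
  then obtain w where "\<And>i. v $ i = zhat_to_adele (w i)"
    unfolding image_iff by metis
  with r show "(v, A) \<in> aff_zhat"
    by (auto simp: aff_zhat_def GL2_zhat_def map_aff_def aff_GL2_def GL2_def image_iff
        vec_eq_iff intro!: exI[of _ "\<chi> i. w i"])
qed (auto simp: aff_zhat_def GL2_zhat_def map_aff_def aff_GL2_def GL2_def)

lemma rat_to_adele_in_zhat_iff: "rat_to_adele q \<in> range zhat_to_adele \<longleftrightarrow> q \<in> \<int>"
  by (auto intro: rat_to_adele_eq_zhat_to_adele elim!: Ints_cases simp: rat_to_adele_of_int)

lemma rat_aff_in_aff_zhat_iff:
  assumes "invertible Q"
  shows "map_aff rat_to_adele (v, Q) \<in> aff_zhat \<longleftrightarrow>
    (\<forall>i. v $ i \<in> \<int>) \<and> Q \<in> map_matrix of_int ` carrier GL2"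
  by (simp add: map_aff_def mem_aff_zhat_iff rat_to_adele_in_zhat_iff rat_matrix_in_GL2_zhat_iff assms)

section \<open>Shimura spaces and fibres of morphisms\<close>

text \<open>Both maps descend to the quotients and become inverse there, with no separation axiom
  involved. That \<open>s\<close> respects the classes of \<open>\<rho>\<close> follows from
  \<open>retract\<close> and \<open>iff\<close>. The lemma yields both the base and the
  fibre.\<close>

lemma quotients_homeomorphic:
  assumes \<pi>: "quotient_map A A' \<pi>" and \<rho>: "quotient_map B B' \<rho>"
    and i: "continuous_map A B i" and s: "continuous_map B A s"
    and retract: "\<And>b. b \<in> topspace B \<Longrightarrow> \<rho> (i (s b)) = \<rho> b"
    and iff: "\<And>a a'. a \<in> topspace A \<Longrightarrow> a' \<in> topspace A \<Longrightarrow> \<rho> (i a) = \<rho> (i a') \<longleftrightarrow> \<pi> a = \<pi> a'"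
  obtains f where "homeomorphic_map A' B' f" "\<And>a. a \<in> topspace A \<Longrightarrow> f (\<pi> a) = \<rho> (i a)"
proof -
  have iA: "i a \<in> topspace B" if "a \<in> topspace A" for a
    using i that by (auto simp: continuous_map_def)
  have sB: "s b \<in> topspace A" if "b \<in> topspace B" for b
    using s that by (auto simp: continuous_map_def)
  have "continuous_map A B' (\<rho> \<circ> i)"
    using i \<rho> continuous_map_compose quotient_imp_continuous_map by blast
  then obtain f where f: "continuous_map A' B' f" "\<And>a. a \<in> topspace A \<Longrightarrow> f (\<pi> a) = \<rho> (i a)"
    by (rule quotient_map_lift_exists[OF \<pi>]) (auto simp: iff)
  have s_const: "\<pi> (s b) = \<pi> (s b')"
    if "b \<in> topspace B" "b' \<in> topspace B" "\<rho> b = \<rho> b'" for b b'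
    using that iff sB retract by metis
  have "continuous_map B A' (\<pi> \<circ> s)"
    using s \<pi> continuous_map_compose quotient_imp_continuous_map by blast
  then obtain g where g: "continuous_map B' A' g" "\<And>b. b \<in> topspace B \<Longrightarrow> g (\<rho> b) = \<pi> (s b)"
    by (rule quotient_map_lift_exists[OF \<rho>]) (auto intro: s_const)
  have "g (f x) = x" if "x \<in> topspace A'" for x
  proof -
    have "x \<in> \<pi> ` topspace A"
      using quotient_imp_surjective_map[OF \<pi>] that by simp
    then obtain a where a: "a \<in> topspace A" "x = \<pi> a"
      by blast
    have "\<pi> (s (i a)) = \<pi> a"
      using iff[of "s (i a)" a] a iA retract sB by auto
    thus ?thesis using a f g iA by auto
  qed
  moreover have "f (g y) = y" if "y \<in> topspace B'" for y
  proof -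
    have "y \<in> \<rho> ` topspace B"
      using quotient_imp_surjective_map[OF \<rho>] that by simp
    then obtain b where "b \<in> topspace B" "y = \<rho> b"
      by blast
    thus ?thesis using f g sB retract by auto
  qed
  ultimately have "homeomorphic_maps A' B' f g"
    using f g by (simp add: homeomorphic_maps_def)
  thus ?thesis
    using that f homeomorphic_maps_imp_map by blast
qed

text \<open>Open sets split into slices over the points of \<open>I\<close>. Hence a group element
  may be chosen arbitrarily as a function of a discrete coordinate without harming
  continuity.\<close>

lemma continuous_map_prod_discrete:
  assumes "\<And>d. d \<in> I \<Longrightarrow> continuous_map X Y (\<lambda>x. h (x, d))"
  shows "continuous_map (prod_topology X (discrete_topology I)) Y h"
  unfolding continuous_map_def
proof (intro conjI allI impI)
  show "h \<in> topspace (prod_topology X (discrete_topology I)) \<rightarrow> topspace Y"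
    using assms by (fastforce simp: continuous_map_def)
  fix U assume "openin Y U"
  hence "openin X {x \<in> topspace X. h (x, d) \<in> U}" if "d \<in> I" for d
    using assms that by (auto simp: continuous_map_def)
  hence "openin (prod_topology X (discrete_topology I))
      (\<Union>d\<in>I. {x \<in> topspace X. h (x, d) \<in> U} \<times> {d})"
    by (intro openin_Union) (auto simp: openin_prod_Times_iff)
  also have "(\<Union>d\<in>I. {x \<in> topspace X. h (x, d) \<in> U} \<times> {d}) =
      {p \<in> topspace (prod_topology X (discrete_topology I)). h p \<in> U}"
    by auto
  finally show "openin (prod_topology X (discrete_topology I))
      {p \<in> topspace (prod_topology X (discrete_topology I)). h p \<in> U}" .
qed

text \<open>Orbits appear throughout as images of the carrier: for points of \<open>Sh\<close>, for
  points of the fibre and for integral orbits of lines. The action laws are restricted to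
  \<open>S\<close> because the maps involved are total functions that act properly only on the
  relevant space.\<close>

lemma orbit_eq_iff:
  assumes "group G" and s: "s \<in> S" "s' \<in> S"
    and closed: "\<And>g x. g \<in> carrier G \<Longrightarrow> x \<in> S \<Longrightarrow> act g x \<in> S"
    and mult: "\<And>g h x. g \<in> carrier G \<Longrightarrow> h \<in> carrier G \<Longrightarrow> x \<in> S \<Longrightarrow>
      act (g \<otimes>\<^bsub>G\<^esub> h) x = act g (act h x)"
    and one: "\<And>x. x \<in> S \<Longrightarrow> act \<one>\<^bsub>G\<^esub> x = x"
  shows "(\<lambda>g. act g s) ` carrier G = (\<lambda>g. act g s') ` carrier G \<longleftrightarrow>
    (\<exists>g\<in>carrier G. act g s = s')"
proof
  interpret group G by fact
  assume "(\<lambda>g. act g s) ` carrier G = (\<lambda>g. act g s') ` carrier G"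
  moreover have "s' \<in> (\<lambda>g. act g s') ` carrier G"
    using one[OF s(2)] by (metis image_eqI one_closed)
  ultimately have "s' \<in> (\<lambda>g. act g s) ` carrier G" by (simp only:)
  thus "\<exists>g\<in>carrier G. act g s = s'" by auto
next
  interpret group G by fact
  assume "\<exists>g\<in>carrier G. act g s = s'"
  then obtain g where g: "g \<in> carrier G" "act g s = s'" by blast
  have "act h s' = act (h \<otimes>\<^bsub>G\<^esub> g) s" if "h \<in> carrier G" for h
    using that g s by (simp add: mult)
  moreover have "act h s = act (h \<otimes>\<^bsub>G\<^esub> inv\<^bsub>G\<^esub> g) s'" if "h \<in> carrier G" for h
    using that g s mult[of "h \<otimes>\<^bsub>G\<^esub> inv\<^bsub>G\<^esub> g" g s] by (simp add: m_assoc)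
  ultimately show "(\<lambda>g. act g s) ` carrier G = (\<lambda>g. act g s') ` carrier G"
    using g(1) by (auto intro!: image_eqI)
qed

section \<open>Cosets of the level subgroup and the spaces \<open>Sh\<close>\<close>

lemma lcosets_iff: "c \<in> lcosets\<^bsub>G\<^esub> K \<longleftrightarrow> (\<exists>a\<in>carrier G. c = a <#\<^bsub>G\<^esub> K)"
  by (auto simp: LCOSETS_def)

lemma (in group) l_coset_eq_subgroup_iff:
  assumes "subgroup K G" "a \<in> carrier G"
  shows "a <# K = K \<longleftrightarrow> a \<in> K"
proof
  assume "a <# K = K"
  thus "a \<in> K" using lcos_self[OF assms(2,1)] by simp
next
  assume a: "a \<in> K"
  show "a <# K = K"
  proof (intro equalityI subsetI)
    fix x assume x: "x \<in> K"
    hence "x = a \<otimes> (inv a \<otimes> x)"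
      using assms a subgroup.mem_carrier[OF assms(1)] by (simp add: m_assoc[symmetric])
    moreover have "inv a \<otimes> x \<in> K"
      using assms a x by (simp add: subgroup.m_closed subgroup.m_inv_closed)
    ultimately show "x \<in> a <# K" by (auto simp: l_coset_def)
  qed (use a assms in \<open>auto simp: l_coset_def subgroup.m_closed\<close>)
qed

text \<open>The quotient is by rational points, so the laws of the real action are demanded only for
  real images of rational points.\<close>

locale shimura_level =
  fixes D :: "('q, 'r, 'a, 'x) pre_shimura_datum" and K :: "'a set"
  assumes group_rat: "group (rat_pts D)" and group_adele: "group (adele_pts D)"
    and to_adele_hom: "to_adele D \<in> hom (rat_pts D) (adele_pts D)"
    and subgroup_level: "subgroup K (adele_pts D)"
    and action_continuous: "q \<in> carrier (rat_pts D) \<Longrightarrow>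
      continuous_map (sym_space D) (sym_space D) (action D (to_real D q))"
    and action_mult: "q \<in> carrier (rat_pts D) \<Longrightarrow> r \<in> carrier (rat_pts D) \<Longrightarrow>
      x \<in> topspace (sym_space D) \<Longrightarrow>
      action D (to_real D (q \<otimes>\<^bsub>rat_pts D\<^esub> r)) x = action D (to_real D q) (action D (to_real D r) x)"
    and action_one: "x \<in> topspace (sym_space D) \<Longrightarrow> action D (to_real D \<one>\<^bsub>rat_pts D\<^esub>) x = x"
begin

sublocale rat: group "rat_pts D" by (rule group_rat)

sublocale adele: group "adele_pts D" by (rule group_adele)

lemma to_adele_closed: "q \<in> carrier (rat_pts D) \<Longrightarrow> to_adele D q \<in> carrier (adele_pts D)"
  using to_adele_hom by (auto simp: hom_def)

lemma to_adele_one: "to_adele D \<one>\<^bsub>rat_pts D\<^esub> = \<one>\<^bsub>adele_pts D\<^esub>"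
  using to_adele_hom group_adele group_rat hom_one by blast

lemma level_subset: "K \<subseteq> carrier (adele_pts D)"
  by (rule subgroup.subset[OF subgroup_level])

lemma action_closed:
  "q \<in> carrier (rat_pts D) \<Longrightarrow> x \<in> topspace (sym_space D) \<Longrightarrow>
    action D (to_real D q) x \<in> topspace (sym_space D)"
  using action_continuous[of q] by (auto simp: continuous_map_def)

lemma topspace_level_space:
  "topspace (level_space D K) = topspace (sym_space D) \<times> lcosets\<^bsub>adele_pts D\<^esub> K"
  by (simp add: level_space_def)

lemma level_in_lcosets: "K \<in> lcosets\<^bsub>adele_pts D\<^esub> K"
  using adele.lcos_mult_one[OF level_subset] by (auto simp: lcosets_iff)

lemma translate_coset:
  "q \<in> carrier (rat_pts D) \<Longrightarrow> a \<in> carrier (adele_pts D) \<Longrightarrow>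
    to_adele D q <#\<^bsub>adele_pts D\<^esub> (a <#\<^bsub>adele_pts D\<^esub> K) = (to_adele D q \<otimes>\<^bsub>adele_pts D\<^esub> a) <#\<^bsub>adele_pts D\<^esub> K"
  by (rule adele.lcos_m_assoc[OF level_subset]) (auto simp: to_adele_closed)

lemma level_act_closed:
  "q \<in> carrier (rat_pts D) \<Longrightarrow> s \<in> topspace (level_space D K) \<Longrightarrow>
    level_act D q s \<in> topspace (level_space D K)"
  by (auto simp: topspace_level_space level_act_def action_closed lcosets_iff translate_coset
      intro!: bexI[of _ "to_adele D q \<otimes>\<^bsub>adele_pts D\<^esub> _"] to_adele_closed adele.m_closed)

lemma level_act_mult:
  assumes "q \<in> carrier (rat_pts D)" "r \<in> carrier (rat_pts D)" "s \<in> topspace (level_space D K)"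
  shows "level_act D (q \<otimes>\<^bsub>rat_pts D\<^esub> r) s = level_act D q (level_act D r s)"
proof -
  obtain x a where s: "s = (x, a <#\<^bsub>adele_pts D\<^esub> K)" "x \<in> topspace (sym_space D)"
      "a \<in> carrier (adele_pts D)"
    using assms(3) by (auto simp: topspace_level_space lcosets_iff)
  have "to_adele D (q \<otimes>\<^bsub>rat_pts D\<^esub> r) = to_adele D q \<otimes>\<^bsub>adele_pts D\<^esub> to_adele D r"
    using to_adele_hom assms by (auto simp: hom_def)
  thus ?thesis
    using assms s adele.lcos_m_assoc[OF level_subset]
    by (simp add: level_act_def action_mult to_adele_closed adele.m_assoc)
qed

lemma level_act_one: "s \<in> topspace (level_space D K) \<Longrightarrow> level_act D \<one>\<^bsub>rat_pts D\<^esub> s = s"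
  by (auto simp: topspace_level_space lcosets_iff level_act_def action_one to_adele_one
      adele.lcos_m_assoc[OF level_subset])

lemma Sh_class_eq_iff:
  "s \<in> topspace (level_space D K) \<Longrightarrow> s' \<in> topspace (level_space D K) \<Longrightarrow>
    Sh_class D s = Sh_class D s' \<longleftrightarrow> (\<exists>q\<in>carrier (rat_pts D). level_act D q s = s')"
  unfolding Sh_class_def
  by (rule orbit_eq_iff[where S = "topspace (level_space D K)"])
    (auto intro: group_rat level_act_closed level_act_mult level_act_one)

lemma translate_level_iff:
  "q \<in> carrier (rat_pts D) \<Longrightarrow> to_adele D q <#\<^bsub>adele_pts D\<^esub> K = K \<longleftrightarrow> to_adele D q \<in> K"
  by (rule adele.l_coset_eq_subgroup_iff[OF subgroup_level to_adele_closed])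

text \<open>When every coset is a rational translate of \<open>K\<close>, every class meets the
  slice of pairs \<open>(x, K)\<close>, and two points of the slice are identified exactly by the
  rational elements that stabilise \<open>K\<close>.\<close>

lemma Sh_homeomorphic_quotient:
  assumes class_number: "\<And>a. a \<in> carrier (adele_pts D) \<Longrightarrow>
      \<exists>q\<in>carrier (rat_pts D). to_adele D q \<otimes>\<^bsub>adele_pts D\<^esub> a \<in> K"
    and \<pi>: "quotient_map (sym_space D) Z \<pi>"
    and \<pi>_eq: "\<And>x x'. x \<in> topspace (sym_space D) \<Longrightarrow> x' \<in> topspace (sym_space D) \<Longrightarrow>
      \<pi> x = \<pi> x' \<longleftrightarrow>
      (\<exists>q\<in>carrier (rat_pts D). to_adele D q \<in> K \<and> action D (to_real D q) x = x')"
  obtains j where "homeomorphic_map Z (Sh D K) j"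
    "\<And>x. x \<in> topspace (sym_space D) \<Longrightarrow> j (\<pi> x) = Sh_class D (x, K)"
proof -
  \<comment> \<open>The implication inside the existential makes the chosen \<open>r\<close> a total
    function with values in the carrier. It depends on the coset only, a discrete coordinate, so
    \<open>s\<close> below is continuous.\<close>
  have "\<exists>q\<in>carrier (rat_pts D). c \<in> lcosets\<^bsub>adele_pts D\<^esub> K \<longrightarrow> to_adele D q <#\<^bsub>adele_pts D\<^esub> c = K" for c
  proof (cases "c \<in> lcosets\<^bsub>adele_pts D\<^esub> K")
    case True
    then obtain a where a: "a \<in> carrier (adele_pts D)" "c = a <#\<^bsub>adele_pts D\<^esub> K"
      by (auto simp: lcosets_iff)
    obtain q where q: "q \<in> carrier (rat_pts D)" "to_adele D q \<otimes>\<^bsub>adele_pts D\<^esub> a \<in> K"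
      using class_number a(1) by blast
    hence "to_adele D q <#\<^bsub>adele_pts D\<^esub> c = K"
      using a level_subset adele.l_coset_eq_subgroup_iff[OF subgroup_level]
      by (auto simp: translate_coset)
    thus ?thesis using q(1) by blast
  qed (use rat.one_closed in blast)
  then obtain r where r: "\<And>c. r c \<in> carrier (rat_pts D)"
      "\<And>c. c \<in> lcosets\<^bsub>adele_pts D\<^esub> K \<Longrightarrow> to_adele D (r c) <#\<^bsub>adele_pts D\<^esub> c = K"
    by metis
  define s where "s = (\<lambda>(x, c). action D (to_real D (r c)) x)"
  have s: "continuous_map (level_space D K) (sym_space D) s"
    unfolding level_space_def
    by (rule continuous_map_prod_discrete) (simp add: s_def action_continuous r)
  have i: "continuous_map (sym_space D) (level_space D K) (\<lambda>x. (x, K))"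
    by (simp add: level_space_def continuous_map_pairwise o_def level_in_lcosets)
  show ?thesis
  proof (rule quotients_homeomorphic[OF \<pi> _ i s])
    show "quotient_map (level_space D K) (Sh D K) (Sh_class D)"
      unfolding Sh_def by (rule quotient_map_quotient_topology)
    show "Sh_class D (s b, K) = Sh_class D b" if b: "b \<in> topspace (level_space D K)" for b
    proof -
      obtain x c where xc: "b = (x, c)" "x \<in> topspace (sym_space D)" "c \<in> lcosets\<^bsub>adele_pts D\<^esub> K"
        using b by (auto simp: topspace_level_space)
      have "level_act D (r c) b = (s b, K)"
        using xc r(2) by (simp add: level_act_def s_def)
      moreover from this have "(s b, K) \<in> topspace (level_space D K)"
        using level_act_closed r(1) b by metis
      ultimately show ?thesis
        using Sh_class_eq_iff[OF b, of "(s b, K)"] r(1) by metis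
    qed
    show "Sh_class D (x, K) = Sh_class D (x', K) \<longleftrightarrow> \<pi> x = \<pi> x'"
      if "x \<in> topspace (sym_space D)" "x' \<in> topspace (sym_space D)" for x x'
      using that Sh_class_eq_iff[of "(x, K)" "(x', K)"]
      by (auto simp: topspace_level_space level_in_lcosets \<pi>_eq level_act_def translate_level_iff)
  qed (use that in auto)
qed

end

section \<open>Morphisms and fibres over an object\<close>

locale shimura_morphism = source: shimura_level D1 K1 + target: shimura_level D2 K2
  for D1 :: "('q1, 'r1, 'a1, 'x1) pre_shimura_datum" and K1
    and D2 :: "('q2, 'r2, 'a2, 'x2) pre_shimura_datum" and K2 +
  fixes m :: "('q1, 'a1, 'x1, 'q2, 'a2, 'x2) pre_shimura_morphism"
  assumes on_rat_hom: "on_rat m \<in> hom (rat_pts D1) (rat_pts D2)"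
    and on_adele_hom: "on_adele m \<in> hom (adele_pts D1) (adele_pts D2)"
    and on_adele_level: "on_adele m ` K1 \<subseteq> K2"
    and on_space_closed: "x \<in> topspace (sym_space D1) \<Longrightarrow> on_space m x \<in> topspace (sym_space D2)"
    and on_space_action: "q \<in> carrier (rat_pts D1) \<Longrightarrow> x \<in> topspace (sym_space D1) \<Longrightarrow>
      on_space m (action D1 (to_real D1 q) x) = action D2 (to_real D2 (on_rat m q)) (on_space m x)"
    and on_adele_to_adele: "q \<in> carrier (rat_pts D1) \<Longrightarrow>
      on_adele m (to_adele D1 q) = to_adele D2 (on_rat m q)"
begin

lemma on_rat_closed: "q \<in> carrier (rat_pts D1) \<Longrightarrow> on_rat m q \<in> carrier (rat_pts D2)"
  using on_rat_hom by (auto simp: hom_def)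

lemma on_adele_closed: "a \<in> carrier (adele_pts D1) \<Longrightarrow> on_adele m a \<in> carrier (adele_pts D2)"
  using on_adele_hom by (auto simp: hom_def)

lemma on_adele_mult: "a \<in> carrier (adele_pts D1) \<Longrightarrow> b \<in> carrier (adele_pts D1) \<Longrightarrow>
    on_adele m (a \<otimes>\<^bsub>adele_pts D1\<^esub> b) = on_adele m a \<otimes>\<^bsub>adele_pts D2\<^esub> on_adele m b"
  using on_adele_hom by (auto simp: hom_def)

text \<open>The image of a coset multiplied by \<open>K2\<close> is one single coset: the image of
  \<open>K1\<close> is absorbed by \<open>K2\<close>, and the unit of \<open>K1\<close> gives the
  converse inclusion.\<close>

lemma level_map_coset:
  assumes a: "a \<in> carrier (adele_pts D1)"
  shows "level_map m D2 K2 (x, a <#\<^bsub>adele_pts D1\<^esub> K1) = (on_space m x, on_adele m a <#\<^bsub>adele_pts D2\<^esub> K2)"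
proof -
  have mem: "k \<in> carrier (adele_pts D1)" if "k \<in> K1" for k
    using that source.level_subset by blast
  have mem2: "k \<in> carrier (adele_pts D2)" if "k \<in> K2" for k
    using that target.level_subset by blast
  have one: "\<one>\<^bsub>adele_pts D1\<^esub> \<in> K1"
    by (rule subgroup.one_closed[OF source.subgroup_level])
  have "on_adele m ` (a <#\<^bsub>adele_pts D1\<^esub> K1) <#>\<^bsub>adele_pts D2\<^esub> K2 =
      {on_adele m a \<otimes>\<^bsub>adele_pts D2\<^esub> (on_adele m k \<otimes>\<^bsub>adele_pts D2\<^esub> l) | k l. k \<in> K1 \<and> l \<in> K2}"
    using a mem mem2
    by (fastforce simp: l_coset_def set_mult_def on_adele_mult target.adele.m_assoc on_adele_closed)
  also have "\<dots> = on_adele m a <#\<^bsub>adele_pts D2\<^esub> K2"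
  proof (intro equalityI subsetI)
    fix y assume "y \<in> on_adele m a <#\<^bsub>adele_pts D2\<^esub> K2"
    then obtain l where l: "l \<in> K2" "y = on_adele m a \<otimes>\<^bsub>adele_pts D2\<^esub> l"
      by (auto simp: l_coset_def)
    have "on_adele m \<one>\<^bsub>adele_pts D1\<^esub> = \<one>\<^bsub>adele_pts D2\<^esub>"
      using on_adele_hom source.group_adele target.group_adele hom_one by blast
    hence "y = on_adele m a \<otimes>\<^bsub>adele_pts D2\<^esub> (on_adele m \<one>\<^bsub>adele_pts D1\<^esub> \<otimes>\<^bsub>adele_pts D2\<^esub> l)"
      using l mem2 by simp
    thus "y \<in> {on_adele m a \<otimes>\<^bsub>adele_pts D2\<^esub> (on_adele m k \<otimes>\<^bsub>adele_pts D2\<^esub> l) | k l. k \<in> K1 \<and> l \<in> K2}"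
      using one l(1) by blast
  next
    fix y assume "y \<in> {on_adele m a \<otimes>\<^bsub>adele_pts D2\<^esub> (on_adele m k \<otimes>\<^bsub>adele_pts D2\<^esub> l) | k l. k \<in> K1 \<and> l \<in> K2}"
    then obtain k l where kl: "k \<in> K1" "l \<in> K2"
      "y = on_adele m a \<otimes>\<^bsub>adele_pts D2\<^esub> (on_adele m k \<otimes>\<^bsub>adele_pts D2\<^esub> l)" by blast
    have "on_adele m k \<otimes>\<^bsub>adele_pts D2\<^esub> l \<in> K2"
      using kl on_adele_level by (intro subgroup.m_closed[OF target.subgroup_level]) auto
    thus "y \<in> on_adele m a <#\<^bsub>adele_pts D2\<^esub> K2" using kl(3) by (auto simp: l_coset_def)
  qed
  finally show ?thesis by (simp add: level_map_def)
qed

lemma level_space_cases: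
  assumes "s \<in> topspace (level_space D1 K1)"
  obtains x a where "s = (x, a <#\<^bsub>adele_pts D1\<^esub> K1)" "x \<in> topspace (sym_space D1)"
    "a \<in> carrier (adele_pts D1)"
  using assms by (auto simp: source.topspace_level_space lcosets_iff)

lemma level_map_closed:
  "s \<in> topspace (level_space D1 K1) \<Longrightarrow> level_map m D2 K2 s \<in> topspace (level_space D2 K2)"
  by (erule level_space_cases)
    (auto simp: level_map_coset target.topspace_level_space on_space_closed on_adele_closed lcosets_iff)

lemma level_map_act:
  assumes "q \<in> carrier (rat_pts D1)" "s \<in> topspace (level_space D1 K1)"
  shows "level_map m D2 K2 (level_act D1 q s) = level_act D2 (on_rat m q) (level_map m D2 K2 s)"
  using assms(2)
proof (rule level_space_cases)
  fix x a assume "s = (x, a <#\<^bsub>adele_pts D1\<^esub> K1)" "x \<in> topspace (sym_space D1)"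
    "a \<in> carrier (adele_pts D1)"
  thus ?thesis
    using assms(1)
    by (simp add: level_act_def source.translate_coset target.translate_coset level_map_coset
        source.to_adele_closed on_rat_closed on_adele_closed on_adele_mult on_adele_to_adele
        on_space_action)
qed

text \<open>Justifies \<open>the_elem\<close> in the definition of \<open>Sh_map\<close>: by
  equivariance an orbit is sent into one orbit, so the set in question is a singleton.\<close>

lemma Sh_map_Sh_class:
  assumes s: "s \<in> topspace (level_space D1 K1)"
  shows "Sh_map m D2 K2 (Sh_class D1 s) = Sh_class D2 (level_map m D2 K2 s)"
proof -
  have "Sh_class D2 (level_map m D2 K2 (level_act D1 q s)) = Sh_class D2 (level_map m D2 K2 s)"
    if q: "q \<in> carrier (rat_pts D1)" for q
  proof -
    have "level_map m D2 K2 (level_act D1 q s) = level_act D2 (on_rat m q) (level_map m D2 K2 s)"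
      by (rule level_map_act[OF q s])
    thus ?thesis
      using target.Sh_class_eq_iff[OF level_map_closed[OF s] level_map_closed[OF source.level_act_closed[OF q s]]]
        on_rat_closed[OF q] by metis
  qed
  hence "(\<lambda>s. Sh_class D2 (level_map m D2 K2 s)) ` Sh_class D1 s = {Sh_class D2 (level_map m D2 K2 s)}"
    using source.rat.one_closed unfolding Sh_class_def[of D1] image_image by (auto simp: image_iff)
  thus ?thesis by (simp add: Sh_map_def)
qed

lemma topspace_fibre_objects:
  "topspace (fibre_objects m D1 K1 D2 K2 t) =
    {(s, g). s \<in> topspace (level_space D1 K1) \<and> g \<in> carrier (rat_pts D2) \<and>
      level_act D2 g (level_map m D2 K2 s) = t}"
  by (auto simp: fibre_objects_def)

text \<open>Multiplying the identification on the right by an inverse gives a left action on pairs,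
  so the orbit criterion applies.\<close>

lemma fibre_class_eq_iff:
  assumes "s \<in> topspace (level_space D1 K1)" "g \<in> carrier (rat_pts D2)"
    "s' \<in> topspace (level_space D1 K1)" "g' \<in> carrier (rat_pts D2)"
  shows "fibre_class m D1 D2 (s, g) = fibre_class m D1 D2 (s', g') \<longleftrightarrow>
    (\<exists>q\<in>carrier (rat_pts D1). level_act D1 q s = s' \<and>
      g \<otimes>\<^bsub>rat_pts D2\<^esub> inv\<^bsub>rat_pts D2\<^esub> (on_rat m q) = g')"
proof -
  define act where "act = (\<lambda>q (s, g). (level_act D1 q s, g \<otimes>\<^bsub>rat_pts D2\<^esub> inv\<^bsub>rat_pts D2\<^esub> (on_rat m q)))"
  define S where "S = topspace (level_space D1 K1) \<times> carrier (rat_pts D2)"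
  have hm: "on_rat m (q \<otimes>\<^bsub>rat_pts D1\<^esub> r) = on_rat m q \<otimes>\<^bsub>rat_pts D2\<^esub> on_rat m r"
    if "q \<in> carrier (rat_pts D1)" "r \<in> carrier (rat_pts D1)" for q r
    using that on_rat_hom by (auto simp: hom_def)
  have one: "on_rat m \<one>\<^bsub>rat_pts D1\<^esub> = \<one>\<^bsub>rat_pts D2\<^esub>"
    using on_rat_hom source.group_rat target.group_rat hom_one by blast
  have "(\<lambda>q. act q (s, g)) ` carrier (rat_pts D1) = (\<lambda>q. act q (s', g')) ` carrier (rat_pts D1) \<longleftrightarrow>
      (\<exists>q\<in>carrier (rat_pts D1). act q (s, g) = (s', g'))"
    by (rule orbit_eq_iff[where S = S])
      (use assms in \<open>auto simp: act_def S_def source.group_rat source.level_act_closed on_rat_closed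
        source.level_act_mult source.level_act_one hm one target.rat.m_assoc target.rat.inv_mult_group\<close>)
  thus ?thesis
    by (simp add: fibre_class_def act_def)
qed

lemma fibre_to_Sh_fibre_class: "fibre_to_Sh D1 (fibre_class m D1 D2 (s, g)) = Sh_class D1 s"
  by (simp add: fibre_to_Sh_def fibre_class_def Sh_class_def image_image)

lemma topspace_fibre_over:
  "topspace (fibre_over m D1 K1 D2 K2 t) =
    fibre_class m D1 D2 ` topspace (fibre_objects m D1 K1 D2 K2 t)"
  by (simp add: fibre_over_def)

text \<open>That a class lies over the class of \<open>t\<close> means that some rational
  \<open>g\<close> moves the image of a representative to \<open>t\<close>; any such
  \<open>g\<close> is the missing identification.\<close>

lemma fibre_to_Sh_image:
  assumes t: "t \<in> topspace (level_space D2 K2)"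
  shows "fibre_to_Sh D1 ` topspace (fibre_over m D1 K1 D2 K2 t) =
    {c \<in> topspace (Sh D1 K1). Sh_map m D2 K2 c = Sh_class D2 t}"
proof (intro equalityI subsetI)
  fix c assume "c \<in> fibre_to_Sh D1 ` topspace (fibre_over m D1 K1 D2 K2 t)"
  then obtain s g where sg: "s \<in> topspace (level_space D1 K1)" "g \<in> carrier (rat_pts D2)"
      "level_act D2 g (level_map m D2 K2 s) = t" "c = Sh_class D1 s"
    by (auto simp: topspace_fibre_over topspace_fibre_objects fibre_to_Sh_fibre_class)
  hence "Sh_class D2 (level_map m D2 K2 s) = Sh_class D2 t"
    using target.Sh_class_eq_iff[OF level_map_closed t] by blast
  thus "c \<in> {c \<in> topspace (Sh D1 K1). Sh_map m D2 K2 c = Sh_class D2 t}"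
    using sg by (auto simp: Sh_def Sh_map_Sh_class)
next
  fix c assume "c \<in> {c \<in> topspace (Sh D1 K1). Sh_map m D2 K2 c = Sh_class D2 t}"
  then obtain s where s: "s \<in> topspace (level_space D1 K1)" "c = Sh_class D1 s"
      "Sh_class D2 (level_map m D2 K2 s) = Sh_class D2 t"
    by (auto simp: Sh_def Sh_map_Sh_class)
  then obtain g where "g \<in> carrier (rat_pts D2)" "level_act D2 g (level_map m D2 K2 s) = t"
    using target.Sh_class_eq_iff[OF level_map_closed t] by blast
  hence "(s, g) \<in> topspace (fibre_objects m D1 K1 D2 K2 t)"
    using s by (simp add: topspace_fibre_objects)
  thus "c \<in> fibre_to_Sh D1 ` topspace (fibre_over m D1 K1 D2 K2 t)"
    unfolding topspace_fibre_over image_image s(2)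
    using fibre_to_Sh_fibre_class by (metis image_eqI)
qed

end

section \<open>The quotient of the conjugacy class\<close>

lemma matrix_image_span: "(*v) A ` span S = span ((*v) A ` S)" for A :: "real ^ 'n ^ 'm"
  by (rule linear_span_image[symmetric]) (rule matrix_vector_mul_linear)

lemma invertible_mult_eq_0_iff:
  fixes A :: "'r::comm_ring_1 ^ 2 ^ 2"
  assumes "invertible A"
  shows "A *v v = 0 \<longleftrightarrow> v = 0"
proof
  obtain B where "B ** A = mat 1" using assms by (auto simp: invertible_def)
  hence "v = B *v (A *v v)" by (simp add: matrix_vector_mul_assoc)
  thus "A *v v = 0 \<Longrightarrow> v = 0" by simp
qed simp

lemma quotient_map_P1_real: "quotient_map (top_of_set (UNIV - {0})) P1_real (\<lambda>v. span {v})"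
  unfolding P1_real_def by (rule quotient_map_quotient_topology)

lemma P1_real_cases:
  assumes "F \<in> topspace P1_real"
  obtains a where "a \<noteq> 0" "F = span {a}"
  using assms by (auto simp: P1_real_def)

lemma subspace_P1_real: "F \<in> topspace P1_real \<Longrightarrow> subspace F"
  by (simp add: topspace_P1_real)

lemma span_in_P1_real: "a \<noteq> 0 \<Longrightarrow> span {a} \<in> topspace P1_real"
  by (auto simp: P1_real_def)

lemma image_P1_real:
  "invertible A \<Longrightarrow> F \<in> topspace P1_real \<Longrightarrow> (*v) A ` F \<in> topspace P1_real"
  by (erule P1_real_cases) (simp add: matrix_image_span span_in_P1_real invertible_mult_eq_0_iff)

lemma continuous_map_P1_real_action:
  assumes "invertible A"
  shows "continuous_map P1_real P1_real (\<lambda>F. (*v) A ` F)"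
proof (rule continuous_compose_quotient_map[OF quotient_map_P1_real])
  have "continuous_map (top_of_set (UNIV - {0})) (top_of_set (UNIV - {0})) ((*v) A)"
    using assms by (auto simp: continuous_map_subtopology_eu invertible_mult_eq_0_iff
        intro!: continuous_intros)
  hence "continuous_map (top_of_set (UNIV - {0})) P1_real ((\<lambda>v. span {v}) \<circ> (*v) A)"
    using quotient_imp_continuous_map[OF quotient_map_P1_real] continuous_map_compose by blast
  also have "(\<lambda>v. span {v}) \<circ> (*v) A = (\<lambda>F. (*v) A ` F) \<circ> (\<lambda>v. span {v})"
    by (simp add: fun_eq_iff matrix_image_span)
  finally show "continuous_map (top_of_set (UNIV - {0})) P1_real ((\<lambda>F. (*v) A ` F) \<circ> (\<lambda>v. span {v}))" .
qed

lemma GL2_datum_simps [simp]: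
  "rat_pts GL2_datum = GL2" "real_pts GL2_datum = GL2" "adele_pts GL2_datum = GL2"
  "to_real GL2_datum = map_matrix of_rat" "to_adele GL2_datum = map_matrix rat_to_adele"
  "sym_space GL2_datum = P1_real" "action GL2_datum = (\<lambda>A F. (*v) A ` F)"
  by (simp_all add: GL2_datum_def)

lemma carrier_GL2 [simp]: "A \<in> carrier GL2 \<longleftrightarrow> invertible A"
  by (simp add: GL2_def)

lemma mult_GL2 [simp]: "A \<otimes>\<^bsub>GL2\<^esub> B = A ** B"
  by (simp add: GL2_def)

lemma one_GL2 [simp]: "\<one>\<^bsub>GL2\<^esub> = mat 1"
  by (simp add: GL2_def)

interpretation GL2: shimura_level GL2_datum GL2_zhat
proof (rule shimura_level.intro)
  show "subgroup GL2_zhat (adele_pts GL2_datum)"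
    by (simp add: GL2_zhat_def zhat_to_adele.subgroup_map_matrix)
  show "to_adele GL2_datum \<in> hom (rat_pts GL2_datum) (adele_pts GL2_datum)"
    by (simp add: rat_to_adele.map_matrix_hom)
qed (auto simp: group_GL2 continuous_map_P1_real_action
    rat_to_real.invertible_map_matrix rat_to_real.map_matrix_mult rat_to_real.map_matrix_one
    image_image matrix_vector_mul_assoc)

lemma of_rat_of_int_matrix: "map_matrix real_of_rat (map_matrix of_int Z) = map_matrix of_int Z"
  by (simp add: vec_eq_iff)

lemma PGL2_int_orbit_eq_iff:
  assumes "F \<in> topspace P1_real" "F' \<in> topspace P1_real"
  shows "PGL2_int_orbit F = PGL2_int_orbit F' \<longleftrightarrow>
    (\<exists>Z :: int ^ 2 ^ 2. invertible Z \<and> (*v) (map_matrix of_int Z) ` F = F')"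
proof -
  have "PGL2_int_orbit F = PGL2_int_orbit F' \<longleftrightarrow>
      (\<exists>Z \<in> carrier (GL2 :: (int ^ 2 ^ 2) monoid). (*v) (map_matrix real_of_int Z) ` F = F')"
    unfolding PGL2_int_orbit_def
    by (rule orbit_eq_iff[where S = "topspace P1_real"])
      (auto simp: group_GL2 assms image_P1_real int_to_real.invertible_map_matrix
        int_to_real.map_matrix_mult int_to_real.map_matrix_one image_image matrix_vector_mul_assoc)
  thus ?thesis by auto
qed

lemma Sh_GL2_homeomorphic:
  obtains j where "homeomorphic_map (quotient_topology P1_real PGL2_int_orbit) (Sh GL2_datum GL2_zhat) j"
    "\<And>F. F \<in> topspace P1_real \<Longrightarrow> j (PGL2_int_orbit F) = Sh_class GL2_datum (F, GL2_zhat)"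
proof (rule GL2.Sh_homeomorphic_quotient[of "quotient_topology P1_real PGL2_int_orbit" PGL2_int_orbit])
  show "\<exists>q\<in>carrier (rat_pts GL2_datum). to_adele GL2_datum q \<otimes>\<^bsub>adele_pts GL2_datum\<^esub> a \<in> GL2_zhat"
    if "a \<in> carrier (adele_pts GL2_datum)" for a
  proof -
    have "invertible a" using that by simp
    then obtain Q K where QK: "invertible Q" "K \<in> GL2_zhat" "a = map_matrix rat_to_adele Q ** K"
      by (rule GL2_adele_decomposition)
    obtain R where R: "Q ** R = mat 1" "R ** Q = mat 1"
      using QK(1) by (auto simp: invertible_def)
    have "map_matrix rat_to_adele R ** a = map_matrix rat_to_adele (R ** Q) ** K"
      by (simp add: QK rat_to_adele.map_matrix_mult matrix_mul_assoc)
    hence "map_matrix rat_to_adele R ** a = K"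
      by (simp add: R rat_to_adele.map_matrix_one)
    thus ?thesis using R QK(2) by (auto intro!: bexI[of _ R] invertibleI[of R Q])
  qed
  show "quotient_map (sym_space GL2_datum) (quotient_topology P1_real PGL2_int_orbit) PGL2_int_orbit"
    by (simp add: quotient_map_quotient_topology)
  show "PGL2_int_orbit F = PGL2_int_orbit F' \<longleftrightarrow>
      (\<exists>q\<in>carrier (rat_pts GL2_datum). to_adele GL2_datum q \<in> GL2_zhat \<and>
        action GL2_datum (to_real GL2_datum q) F = F')"
    if "F \<in> topspace (sym_space GL2_datum)" "F' \<in> topspace (sym_space GL2_datum)" for F F'
  proof -
    have "(\<exists>q\<in>carrier GL2. map_matrix rat_to_adele q \<in> GL2_zhat \<and> (*v) (map_matrix real_of_rat q) ` F = F')
        \<longleftrightarrow> (\<exists>Z. invertible Z \<and> (*v) (map_matrix real_of_rat (map_matrix of_int Z)) ` F = F')"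
      by (auto simp: rat_matrix_in_GL2_zhat_iff int_to_rat.invertible_map_matrix)
        (metis carrier_GL2 image_eqI int_to_rat.invertible_map_matrix rat_matrix_in_GL2_zhat_iff)
    thus ?thesis
      using that by (simp add: PGL2_int_orbit_eq_iff of_rat_of_int_matrix)
  qed
qed (use that in auto)

section \<open>Conjugates of \<open>h0\<close> and their fixed vectors\<close>

lemma carrier_aff_GL2 [simp]: "(v, A) \<in> carrier aff_GL2 \<longleftrightarrow> invertible A"
  by (simp add: aff_GL2_def)

lemma mult_aff_GL2 [simp]: "(v, A) \<otimes>\<^bsub>aff_GL2\<^esub> (w, B) = (v + A *v w, A ** B)"
  by (simp add: aff_GL2_def)

lemma one_aff_GL2: "\<one>\<^bsub>aff_GL2\<^esub> = (0, mat 1)"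
  by (simp add: aff_GL2_def)

lemma inv_aff_GL2:
  assumes "A ** B = mat 1" "B ** A = mat 1"
  shows "inv\<^bsub>aff_GL2\<^esub> (v, A) = (- (B *v v), B)"
  using assms invertibleI[of A B] invertibleI[of B A]
  by (intro group.inv_equality[OF group_aff_GL2]) (auto simp: one_aff_GL2)

lemma h0_eq: "t \<in> torus_pts \<Longrightarrow> h0 t = (0, vector [vector [fst t * snd t, 0], vector [0, 1]])"
  by (simp add: h0_def split: prod.split)

lemma h0_in_carrier: "t \<in> torus_pts \<Longrightarrow> h0 t \<in> carrier aff_GL2"
  by (auto simp: h0_eq torus_pts_def invertible_det_nz det_2)

lemma conj_cochar_conj_cochar:
  assumes g: "g \<in> carrier aff_GL2" and h: "h \<in> carrier aff_GL2"
  shows "conj_cochar g (conj_cochar h h0) = conj_cochar (g \<otimes>\<^bsub>aff_GL2\<^esub> h) h0"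
proof -
  interpret group "aff_GL2 :: real aff_pts monoid" by (rule group_aff_GL2)
  show ?thesis
    using g h by (auto simp: conj_cochar_def restrict_def m_assoc inv_mult_group h0_in_carrier fun_eq_iff)
qed

lemma matrix_vector_mult_uminus: "A *v (- x) = - (A *v x)" for A :: "'r::comm_ring_1 ^ 'n ^ 'm"
  by (simp add: matrix_vector_mult_def vec_eq_iff sum_negf)

text \<open>The value is the affine map with linear part \<open>C\<close> that fixes the point
  \<open>v\<close>, since \<open>h0\<close> fixes the origin.\<close>

lemma conj_cochar_h0:
  assumes "A ** B = mat 1" "B ** A = mat 1" "t \<in> torus_pts"
  defines "C \<equiv> A ** snd (h0 t) ** B"
  shows "conj_cochar (v, A) h0 t = (v - C *v v, C)"
  using assms by (simp add: conj_cochar_def h0_eq inv_aff_GL2 matrix_vector_mul_assoc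
      matrix_mul_assoc matrix_vector_mult_uminus)

text \<open>\<open>h0\<close> fixes exactly the second coordinate axis, and conjugation carries this
  axis to the line spanned by the second column of \<open>A\<close>.\<close>

lemma fixed_by_conj_h0_iff:
  fixes A :: "real ^ 2 ^ 2"
  assumes A: "invertible A"
  shows "(\<forall>t\<in>torus_pts. snd (conj_cochar (v, A) h0 t) *v z = z) \<longleftrightarrow> z \<in> span {column 2 A}"
proof -
  obtain B where B: "A ** B = mat 1" "B ** A = mat 1"
    using A by (auto simp: invertible_def)
  have snd_eq: "snd (conj_cochar (v, A) h0 t) = A ** snd (h0 t) ** B" if "t \<in> torus_pts" for t
    using conj_cochar_h0[OF B that] by simp
  have AB: "A *v (B *v w) = w" "B *v (A *v w) = w" for w
    using B by (simp_all add: matrix_vector_mul_assoc)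
  have col: "A *v axis 2 c = c *\<^sub>R column 2 A" for c
    by (simp add: vec_eq_iff matrix_vector_mult_def column_def axis_def forall_2 sum_2)
  have h0_mult: "snd (h0 t) *v w = vector [fst t * snd t * w $ 1, w $ 2]" if "t \<in> torus_pts" for t w
    using that by (simp add: h0_eq vec_eq_iff forall_2 matrix_vector_mult_def sum_2)
  have "(\<forall>t\<in>torus_pts. snd (conj_cochar (v, A) h0 t) *v z = z) \<longleftrightarrow>
      (\<forall>t\<in>torus_pts. snd (h0 t) *v (B *v z) = B *v z)"
    using AB by (auto simp: snd_eq simp flip: matrix_vector_mul_assoc) metis+
  also have "\<dots> \<longleftrightarrow> (\<forall>t\<in>torus_pts. (fst t * snd t - 1) * (B *v z) $ 1 = 0)"
    by (rule ball_cong[OF refl])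
      (auto simp: h0_mult vec_eq_iff[of "vector _"] forall_2 vector_2 algebra_simps)
  also have "\<dots> \<longleftrightarrow> (B *v z) $ 1 = 0"
  proof
    assume all: "\<forall>t\<in>torus_pts. (fst t * snd t - 1) * (B *v z) $ 1 = 0"
    \<comment> \<open>A single torus point with \<open>x * y\<close> different from 1 already
      detects the first coordinate.\<close>
    have "(2, 1) \<in> torus_pts" by (simp add: torus_pts_def)
    from bspec[OF all this] show "(B *v z) $ 1 = 0" by simp
  qed simp
  also have "\<dots> \<longleftrightarrow> (\<exists>c. B *v z = axis 2 c)"
    by (auto simp: vec_eq_iff[of "B *v z"] forall_2 axis_def)
  also have "\<dots> \<longleftrightarrow> (\<exists>c. z = c *\<^sub>R column 2 A)"
    using AB col by metis
  also have "\<dots> \<longleftrightarrow> z \<in> span {column 2 A}"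
    by (auto simp: span_singleton)
  finally show ?thesis .
qed

lemma F0_line_conj_h0: "invertible A \<Longrightarrow> F0_line (conj_cochar (v, A) h0) = span {column 2 A}"
  using fixed_by_conj_h0_iff[of A v] by (auto simp: F0_line_def)

lemma aff_matrix_fixes_iff:
  "aff_matrix (w, C) *v u = u \<longleftrightarrow>
    C *v vector [u $ 1, u $ 2] + u $ 3 *\<^sub>R w = vector [u $ 1, u $ 2]"
  by (simp add: aff_matrix_def vec_eq_iff forall_3 forall_2 matrix_vector_mult_def sum_3 sum_2
      vector_3 vector_2 algebra_simps)

text \<open>As the affine maps fix \<open>v\<close>, a vector \<open>(w, s)\<close> is fixed if and
  only if \<open>w - s v\<close> is fixed by the linear parts. The result is the plane spanned by
  \<open>(v, 1)\<close> and the line placed at height 0.\<close>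

lemma F0_space_conj_h0:
  assumes A: "invertible A"
  shows "F0_space (conj_cochar (v, A) h0) =
    {u. vector [u $ 1, u $ 2] - u $ 3 *\<^sub>R v \<in> span {column 2 A}}"
proof -
  obtain B where B: "A ** B = mat 1" "B ** A = mat 1"
    using A by (auto simp: invertible_def)
  have "aff_matrix (conj_cochar (v, A) h0 t) *v u = u \<longleftrightarrow>
      snd (conj_cochar (v, A) h0 t) *v (vector [u $ 1, u $ 2] - u $ 3 *\<^sub>R v) =
        vector [u $ 1, u $ 2] - u $ 3 *\<^sub>R v"
    if "t \<in> torus_pts" for t u
    unfolding conj_cochar_h0[OF B that] aff_matrix_fixes_iff
    by (simp add: matrix_vector_right_distrib matrix_vector_mult_diff_distrib
        matrix_vector_mult_scaleR scaleR_diff_right) (auto simp: algebra_simps)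
  thus ?thesis
    using fixed_by_conj_h0_iff[OF A, of v] by (simp add: F0_space_def)
qed

section \<open>Coordinates on the quotient of the conjugacy class: a line and a vector modulo
  it\<close>

lemma topspace_Y_P: "topspace Y_P = (\<lambda>g. conj_cochar g h0) ` carrier aff_GL2"
  by (simp add: Y_P_def)

lemma Y_P_cases:
  assumes "h \<in> topspace Y_P"
  obtains v A where "invertible A" "h = conj_cochar (v, A) h0"
  using assms by (auto simp: topspace_Y_P)

lemma conj_h0_in_Y_P: "invertible A \<Longrightarrow> conj_cochar (v, A) h0 \<in> topspace Y_P"
  by (auto simp: topspace_Y_P)

lemma conj_h0_in_Y_P_point_iff:
  assumes "invertible A"
  shows "conj_cochar (w, A) h0 \<in> Y_P_point F v \<longleftrightarrow> span {column 2 A} = F \<and> v - w \<in> F"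
proof -
  have "vector [v $ 1, v $ 2] = v"
    by (simp add: vec_eq_iff forall_2 vector_2)
  thus ?thesis
    using assms by (auto simp: Y_P_point_def conj_h0_in_Y_P F0_line_conj_h0 F0_space_conj_h0 vector_3)
qed

lemma column_2_eq: "column 2 A = A *v axis 2 1" for A :: "real ^ 2 ^ 2"
  by (simp add: matrix_vector_mult_basis)

lemma column_2_mult: "column 2 (B ** A) = B *v column 2 A" for A B :: "real ^ 2 ^ 2"
  by (simp add: column_2_eq matrix_vector_mul_assoc del: matrix_vector_mult_basis)

lemma column_2_nonzero: "invertible A \<Longrightarrow> column 2 A \<noteq> 0" for A :: "real ^ 2 ^ 2"
  by (simp add: column_2_eq invertible_mult_eq_0_iff del: matrix_vector_mult_basis)

lemma matrix_with_column_span: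
  assumes "F \<in> topspace P1_real"
  obtains A :: "real ^ 2 ^ 2" where "invertible A" "span {column 2 A} = F"
  using assms
proof (rule P1_real_cases)
  fix a :: "real ^ 2" assume a: "a \<noteq> 0" "F = span {a}"
  \<comment> \<open>The first column is \<open>a\<close> rotated by a right angle, so the
    determinant is the squared norm of \<open>a\<close>.\<close>
  define A :: "real ^ 2 ^ 2" where "A = vector [vector [a $ 2, a $ 1], vector [- (a $ 1), a $ 2]]"
  have "det A = (a $ 1)\<^sup>2 + (a $ 2)\<^sup>2"
    by (simp add: A_def det_2 power2_eq_square)
  hence "invertible A"
    using a(1) by (auto simp: invertible_det_nz sum_power2_eq_zero_iff vec_eq_iff forall_2)
  moreover have "column 2 A = a"
    by (simp add: A_def column_def vec_eq_iff forall_2)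
  ultimately show ?thesis using that a(2) by simp
qed

lemma Y_P_point_eq_iff:
  assumes "F \<in> topspace P1_real" "F' \<in> topspace P1_real"
  shows "Y_P_point F v = Y_P_point F' v' \<longleftrightarrow> F = F' \<and> v - v' \<in> F"
proof
  obtain A :: "real ^ 2 ^ 2" where A: "invertible A" "span {column 2 A} = F"
    using assms(1) by (rule matrix_with_column_span)
  have F: "subspace F" using assms(1) by (rule subspace_P1_real)
  assume "Y_P_point F v = Y_P_point F' v'"
  moreover have "conj_cochar (v, A) h0 \<in> Y_P_point F v"
    using A F by (simp add: conj_h0_in_Y_P_point_iff subspace_0)
  ultimately have "F = F' \<and> v' - v \<in> F"
    using conj_h0_in_Y_P_point_iff[OF A(1)] A(2) by auto
  thus "F = F' \<and> v - v' \<in> F"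
    using subspace_neg[OF F, of "v' - v"] by (metis minus_diff_eq)
next
  assume eq: "F = F' \<and> v - v' \<in> F"
  have F: "subspace F" using assms(1) by (rule subspace_P1_real)
  have "v - w \<in> F \<longleftrightarrow> v' - w \<in> F" for w
    using eq F subspace_add[of F "v' - w" "v - v'"] subspace_diff[of F "v - w" "v - v'"]
    by (auto simp: algebra_simps)
  moreover have "h \<in> topspace Y_P" if "h \<in> Y_P_point G u" for h G u
    using that by (simp add: Y_P_point_def)
  ultimately show "Y_P_point F v = Y_P_point F' v'"
    using eq by (intro Set.set_eqI) (metis Y_P_cases conj_h0_in_Y_P_point_iff)
qed

text \<open>The plane \<open>F0_space\<close> and the pair of a line and a vector modulo it
  determine each other: height 0 of the plane is the line, and height 1 is the translate of the line
  by the vector.\<close>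

lemma Y_P_class_eq:
  assumes A: "invertible A"
  shows "Y_P_class (conj_cochar (v, A) h0) = Y_P_point (span {column 2 A}) v"
proof (intro Set.set_eqI)
  fix h
  let ?S = "\<lambda>(F :: (real ^ 2) set) v. {u :: real ^ 3. vector [u $ 1, u $ 2] - u $ 3 *\<^sub>R v \<in> F}"
  have S: "?S F v = ?S F' v' \<longleftrightarrow> F = F' \<and> v - v' \<in> F" if "subspace F" "subspace F'" for F F' v v'
  proof
    assume eq: "?S F v = ?S F' v'"
    have "z \<in> F \<longleftrightarrow> z \<in> F'" for z :: "real ^ 2"
    proof -
      have "vector [z $ 1, z $ 2] = z" by (simp add: vec_eq_iff forall_2)
      thus ?thesis using arg_cong[OF eq, of "\<lambda>S. vector [z $ 1, z $ 2, 0] \<in> S"] by simp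
    qed
    moreover have "v - v' \<in> F'"
    proof -
      have "vector [v $ 1, v $ 2] = v" by (simp add: vec_eq_iff forall_2)
      thus ?thesis
        using arg_cong[OF eq, of "\<lambda>S. vector [v $ 1, v $ 2, 1] \<in> S"] that by (simp add: subspace_0)
    qed
    ultimately show "F = F' \<and> v - v' \<in> F" by blast
  next
    assume eq: "F = F' \<and> v - v' \<in> F"
    have "w - s *\<^sub>R v \<in> F \<longleftrightarrow> w - s *\<^sub>R v' \<in> F" for w s
    proof -
      have "s *\<^sub>R (v - v') \<in> F" using eq subspace_scale[OF that(1)] by blast
      thus ?thesis
        using subspace_add[OF that(1), of "w - s *\<^sub>R v" "s *\<^sub>R (v - v')"]
          subspace_diff[OF that(1), of "w - s *\<^sub>R v'" "s *\<^sub>R (v - v')"]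
        by (auto simp: algebra_simps)
    qed
    thus "?S F v = ?S F' v'" using eq by simp
  qed
  show "h \<in> Y_P_class (conj_cochar (v, A) h0) \<longleftrightarrow> h \<in> Y_P_point (span {column 2 A}) v"
  proof (cases "h \<in> topspace Y_P")
    case True
    then obtain w B where h: "invertible B" "h = conj_cochar (w, B) h0"
      by (rule Y_P_cases)
    have "w - v \<in> span {column 2 B} \<longleftrightarrow> v - w \<in> span {column 2 B}"
      using span_neg[of "w - v"] span_neg[of "v - w"] by auto
    thus ?thesis
      using True S[of "span {column 2 B}" "span {column 2 A}" w v]
      by (auto simp: Y_P_class_def h F0_space_conj_h0 A conj_h0_in_Y_P_point_iff)
  qed (auto simp: Y_P_class_def Y_P_point_def)
qed

text \<open>The two successive quotients compose, so \<open>Y_P_bar\<close> is a quotient of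
  \<open>P(R)\<close> itself. Continuity of maps out of it can then be tested on pairs
  \<open>(v, A)\<close>.\<close>

lemma quotient_map_Y_P_bar:
  "quotient_map (top_of_set (carrier aff_GL2)) Y_P_bar (\<lambda>(v, A). Y_P_point (span {column 2 A}) v)"
proof -
  have "quotient_map (top_of_set (carrier aff_GL2)) Y_P_bar (Y_P_class \<circ> (\<lambda>g. conj_cochar g h0))"
    unfolding Y_P_bar_def Y_P_def
    by (rule quotient_map_compose[OF quotient_map_quotient_topology quotient_map_quotient_topology])
  thus ?thesis
    by (rule quotient_map_eq) (auto simp: Y_P_class_eq)
qed

lemma topspace_Y_P_bar: "topspace Y_P_bar = {Y_P_point F v | F v. F \<in> topspace P1_real}"
proof (intro equalityI subsetI)
  fix c assume "c \<in> topspace Y_P_bar"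
  hence "c \<in> (\<lambda>(v, A). Y_P_point (span {column 2 A}) v) ` carrier aff_GL2"
    using quotient_imp_surjective_map[OF quotient_map_Y_P_bar] by simp
  then obtain v and A :: "real ^ 2 ^ 2" where "invertible A" "c = Y_P_point (span {column 2 A}) v"
    by auto
  thus "c \<in> {Y_P_point F v | F v. F \<in> topspace P1_real}"
    using span_in_P1_real[OF column_2_nonzero] by blast
next
  fix c assume "c \<in> {Y_P_point F v | F v. F \<in> topspace P1_real}"
  then obtain F v where c: "c = Y_P_point F v" "F \<in> topspace P1_real" by blast
  obtain A :: "real ^ 2 ^ 2" where A: "invertible A" "span {column 2 A} = F"
    using c(2) by (rule matrix_with_column_span)
  have "c \<in> (\<lambda>(v, A). Y_P_point (span {column 2 A}) v) ` carrier aff_GL2"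
    by (rule image_eqI[of _ _ "(v, A)"]) (use c A in auto)
  thus "c \<in> topspace Y_P_bar"
    using quotient_imp_surjective_map[OF quotient_map_Y_P_bar] by simp
qed

lemma conj_cochar_in_Y_P_point:
  assumes "invertible B" "h \<in> Y_P_point F v"
  shows "conj_cochar (w, B) h \<in> Y_P_point ((*v) B ` F) (w + B *v v)"
proof -
  have "h \<in> topspace Y_P" using assms(2) by (simp add: Y_P_point_def)
  then obtain u A where h: "invertible A" "h = conj_cochar (u, A) h0"
    by (rule Y_P_cases)
  have F: "F = span {column 2 A}" "v - u \<in> F"
    using assms(2) h by (auto simp: conj_h0_in_Y_P_point_iff)
  have "span {column 2 (B ** A)} = (*v) B ` F"
    by (simp add: F matrix_image_span column_2_mult)
  moreover have "w + B *v v - (w + B *v u) \<in> (*v) B ` F"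
    using F(2) by (simp add: matrix_vector_mult_diff_distrib[symmetric])
  ultimately show ?thesis
    using h assms(1)
    by (simp add: conj_cochar_conj_cochar conj_h0_in_Y_P_point_iff invertible_mult)
qed

lemma conj_cochar_image_Y_P_point:
  assumes B: "invertible B"
  shows "conj_cochar (w, B) ` Y_P_point F v = Y_P_point ((*v) B ` F) (w + B *v v)"
proof (intro equalityI subsetI)
  fix h assume h: "h \<in> Y_P_point ((*v) B ` F) (w + B *v v)"
  obtain C where C: "B ** C = mat 1" "C ** B = mat 1"
    using B by (auto simp: invertible_def)
  have invC: "invertible C" by (rule invertibleI[OF C(2,1)])
  \<comment> \<open>\<open>(- (C *v w), C)\<close> is the inverse of \<open>(w, B)\<close>; the
    inclusion already shown for conjugation, applied to it, gives the reverse one.\<close>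
  have "conj_cochar (- (C *v w), C) h \<in>
      Y_P_point ((*v) C ` (*v) B ` F) (- (C *v w) + C *v (w + B *v v))"
    by (rule conj_cochar_in_Y_P_point[OF invC h])
  hence "conj_cochar (- (C *v w), C) h \<in> Y_P_point F v"
    by (simp add: image_image matrix_vector_mul_assoc matrix_vector_right_distrib C)
  moreover obtain u A where uA: "invertible A" "h = conj_cochar (u, A) h0"
    using h by (auto simp: Y_P_point_def elim: Y_P_cases)
  have "conj_cochar (w, B) (conj_cochar (- (C *v w), C) h) = h"
    using uA B invC
    by (simp add: conj_cochar_conj_cochar invertible_mult matrix_vector_right_distrib
        matrix_vector_mul_assoc matrix_mul_assoc C)
      (simp add: C matrix_vector_mult_diff_distrib matrix_vector_mul_assoc)
  ultimately show "h \<in> conj_cochar (w, B) ` Y_P_point F v"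
    by (metis image_eqI)
qed (use conj_cochar_in_Y_P_point[OF B] in auto)

lemma continuous_on_column: "continuous_on S (\<lambda>A :: real ^ 'n ^ 'm. column k A)"
  unfolding column_def by (intro continuous_intros)

lemma continuous_on_aff_mult:
  "continuous_on S (\<lambda>g :: real aff_pts. (w, B) \<otimes>\<^bsub>aff_GL2\<^esub> g)"
proof -
  have "(\<lambda>g :: real aff_pts. (w, B) \<otimes>\<^bsub>aff_GL2\<^esub> g) =
      (\<lambda>g. (\<chi> i. w $ i + (\<Sum>k\<in>UNIV. B $ i $ k * fst g $ k), \<chi> i j. \<Sum>k\<in>UNIV. B $ i $ k * snd g $ k $ j))"
    by (auto simp: fun_eq_iff matrix_matrix_mult_def matrix_vector_mult_def vec_eq_iff)
  thus ?thesis
    by (simp only:) (intro continuous_intros)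
qed

lemma continuous_map_Y_P_bar_action:
  assumes B: "invertible B"
  shows "continuous_map Y_P_bar Y_P_bar (\<lambda>c. conj_cochar (w, B) ` c)"
proof (rule continuous_compose_quotient_map[OF quotient_map_Y_P_bar])
  let ?\<kappa> = "\<lambda>(v, A :: real ^ 2 ^ 2). Y_P_point (span {column 2 A}) v"
  have "continuous_map (top_of_set (carrier aff_GL2)) (top_of_set (carrier aff_GL2))
      ((\<otimes>\<^bsub>aff_GL2\<^esub>) (w, B))"
    using B by (auto simp: continuous_map_subtopology_eu continuous_on_aff_mult invertible_mult)
  hence "continuous_map (top_of_set (carrier aff_GL2)) Y_P_bar (?\<kappa> \<circ> (\<otimes>\<^bsub>aff_GL2\<^esub>) (w, B))"
    using quotient_imp_continuous_map[OF quotient_map_Y_P_bar] continuous_map_compose by blast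
  also have "?\<kappa> \<circ> (\<otimes>\<^bsub>aff_GL2\<^esub>) (w, B) = (\<lambda>c. conj_cochar (w, B) ` c) \<circ> ?\<kappa>"
    by (auto simp: fun_eq_iff conj_cochar_image_Y_P_point[OF B] column_2_mult matrix_image_span)
  finally show "continuous_map (top_of_set (carrier aff_GL2)) Y_P_bar
      ((\<lambda>c. conj_cochar (w, B) ` c) \<circ> ?\<kappa>)" .
qed

section \<open>The affine datum and its projection\<close>

lemma aff_datum_simps [simp]:
  "rat_pts aff_datum = aff_GL2" "real_pts aff_datum = aff_GL2" "adele_pts aff_datum = aff_GL2"
  "to_real aff_datum = map_aff of_rat" "to_adele aff_datum = map_aff rat_to_adele"
  "sym_space aff_datum = Y_P_bar" "action aff_datum = (\<lambda>g c. conj_cochar g ` c)"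
  by (simp_all add: aff_datum_def)

lemma map_aff_pair: "map_aff f (v, A) = (\<chi> i. f (v $ i), map_matrix f A)"
  by (simp add: map_aff_def)

lemma action_Y_P_point:
  assumes "invertible Q"
  shows "conj_cochar (map_aff of_rat (m, Q)) ` Y_P_point F v =
    Y_P_point ((*v) (map_matrix of_rat Q) ` F) ((\<chi> i. of_rat (m $ i)) + map_matrix of_rat Q *v v)"
  unfolding map_aff_pair
  by (rule conj_cochar_image_Y_P_point) (rule rat_to_real.invertible_map_matrix[OF assms])

lemma of_rat_affine:
  "(\<chi> i. real_of_rat (m $ i + (Q *v n) $ i)) =
    (\<chi> i. of_rat (m $ i)) + map_matrix of_rat Q *v (\<chi> i. of_rat (n $ i))"
  by (simp add: vec_eq_iff of_rat_add flip: rat_to_real.map_matrix_vector_mult)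

interpretation aff: shimura_level aff_datum aff_zhat
proof (rule shimura_level.intro)
  show "subgroup aff_zhat (adele_pts aff_datum)"
    by (simp add: aff_zhat_def zhat_to_adele.subgroup_map_aff)
  show "to_adele aff_datum \<in> hom (rat_pts aff_datum) (adele_pts aff_datum)"
    by (simp add: rat_to_adele.map_aff_hom)
  show "continuous_map (sym_space aff_datum) (sym_space aff_datum) (action aff_datum (to_real aff_datum q))"
    if "q \<in> carrier (rat_pts aff_datum)" for q
    using that by (cases q) (simp add: map_aff_pair continuous_map_Y_P_bar_action rat_to_real.invertible_map_matrix)
  show "action aff_datum (to_real aff_datum (q \<otimes>\<^bsub>rat_pts aff_datum\<^esub> r)) x =
      action aff_datum (to_real aff_datum q) (action aff_datum (to_real aff_datum r) x)"
    if q: "q \<in> carrier (rat_pts aff_datum)" and r: "r \<in> carrier (rat_pts aff_datum)"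
      and x: "x \<in> topspace (sym_space aff_datum)" for q r x
  proof -
    obtain F v where "x = Y_P_point F v"
      using x by (auto simp: topspace_Y_P_bar)
    thus ?thesis
      using q r by (cases q; cases r)
        (simp add: action_Y_P_point invertible_mult image_image rat_to_real.map_matrix_mult
          matrix_vector_mul_assoc matrix_vector_right_distrib add.assoc of_rat_affine)
  qed
  show "action aff_datum (to_real aff_datum \<one>\<^bsub>rat_pts aff_datum\<^esub>) x = x"
    if x: "x \<in> topspace (sym_space aff_datum)" for x
  proof -
    obtain F v where "x = Y_P_point F v"
      using x by (auto simp: topspace_Y_P_bar)
    moreover have "(\<chi> i. real_of_rat ((0 :: rat ^ 2) $ i)) = 0" by (simp add: vec_eq_iff)
    ultimately show ?thesis
      by (simp add: one_aff_GL2 action_Y_P_point rat_to_real.map_matrix_one invertible_def[of "mat 1"])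
  qed
qed (auto simp: group_aff_GL2)

lemma aff_proj_simps [simp]:
  "on_rat aff_proj = snd" "on_adele aff_proj = snd"
  "on_space aff_proj = (\<lambda>c. the_elem (F0_line ` c))"
  by (simp_all add: aff_proj_def)

lemma on_space_Y_P_point:
  assumes "F \<in> topspace P1_real"
  shows "on_space aff_proj (Y_P_point F v) = F"
proof -
  obtain A :: "real ^ 2 ^ 2" where A: "invertible A" "span {column 2 A} = F"
    using assms by (rule matrix_with_column_span)
  hence "conj_cochar (v, A) h0 \<in> Y_P_point F v"
    using subspace_0[OF subspace_P1_real[OF assms]] by (simp add: conj_h0_in_Y_P_point_iff)
  moreover have "F0_line h = F" if "h \<in> Y_P_point F v" for h
    using that by (simp add: Y_P_point_def)
  ultimately have "F0_line ` Y_P_point F v = {F}"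
    by (auto simp: image_iff intro!: bexI)
  thus ?thesis by simp
qed

interpretation aff_GL2: shimura_morphism aff_datum aff_zhat GL2_datum GL2_zhat aff_proj
proof (intro shimura_morphism.intro shimura_morphism_axioms.intro)
  show "on_rat aff_proj \<in> hom (rat_pts aff_datum) (rat_pts GL2_datum)"
    "on_adele aff_proj \<in> hom (adele_pts aff_datum) (adele_pts GL2_datum)"
    by (auto simp: hom_def)
  show "on_adele aff_proj ` aff_zhat \<subseteq> GL2_zhat"
    by (auto simp: mem_aff_zhat_iff)
  show "on_adele aff_proj (to_adele aff_datum q) = to_adele GL2_datum (on_rat aff_proj q)" for q
    by (cases q) (simp add: map_aff_pair)
  show "on_space aff_proj x \<in> topspace (sym_space GL2_datum)"
    if "x \<in> topspace (sym_space aff_datum)" for x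
    using that by (auto simp: topspace_Y_P_bar on_space_Y_P_point simp del: aff_proj_simps)
  show "on_space aff_proj (action aff_datum (to_real aff_datum q) x) =
      action GL2_datum (to_real GL2_datum (on_rat aff_proj q)) (on_space aff_proj x)"
    if q: "q \<in> carrier (rat_pts aff_datum)" and x: "x \<in> topspace (sym_space aff_datum)" for q x
  proof -
    obtain F v where F: "F \<in> topspace P1_real" "x = Y_P_point F v"
      using x by (auto simp: topspace_Y_P_bar)
    obtain m Q where mQ: "q = (m, Q)" "invertible Q" using q by (cases q) simp
    show ?thesis
      using F mQ image_P1_real[OF rat_to_real.invertible_map_matrix[OF mQ(2)] F(1)]
      by (simp add: action_Y_P_point on_space_Y_P_point del: aff_proj_simps(3))
  qed
qed (rule aff.shimura_level_axioms GL2.shimura_level_axioms)+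

text \<open>
  The component of the translation part perpendicular to the line is a continuous choice of
  representative modulo the line, valid on the whole space at once.
\<close>

lemma Y_P_bar_representative:
  obtains p where "continuous_map Y_P_bar euclidean p"
    "\<And>F v. F \<in> topspace P1_real \<Longrightarrow> p (Y_P_point F v) - v \<in> F"
proof -
  \<comment> \<open>Subtracts from \<open>v\<close> its orthogonal projection onto the second
    column, which spans the line.\<close>
  define r where "r = (\<lambda>(v, A :: real ^ 2 ^ 2).
    v - ((v \<bullet> column 2 A) / (column 2 A \<bullet> column 2 A)) *\<^sub>R column 2 A)"
  let ?\<kappa> = "\<lambda>(v, A :: real ^ 2 ^ 2). Y_P_point (span {column 2 A}) v"
  have "continuous_on (carrier aff_GL2) r"
    unfolding r_def case_prod_unfold
    by (intro continuous_intros continuous_on_compose2[OF continuous_on_column[of UNIV]])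
      (auto dest: column_2_nonzero)
  hence r: "continuous_map (top_of_set (carrier aff_GL2)) euclidean r"
    by simp
  \<comment> \<open>The formula is unchanged when the spanning vector is rescaled or when a multiple
    of it is added to \<open>v\<close>; hence it descends to \<open>Y_P_bar\<close>.\<close>
  have const: "r (v, A) = r (w, B)"
    if "invertible A" "invertible B" "Y_P_point (span {column 2 A}) v = Y_P_point (span {column 2 B}) w"
    for v w A B
  proof -
    define a where "a = column 2 A"
    define b where "b = column 2 B"
    have a: "a \<noteq> 0" "b \<noteq> 0"
      using that(1,2) by (simp_all add: a_def b_def column_2_nonzero)
    hence "span {a} = span {b}" "v - w \<in> span {a}"
      using iffD1[OF Y_P_point_eq_iff[OF span_in_P1_real span_in_P1_real] that(3)]
      unfolding a_def b_def by blast+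
    moreover from this have "b \<in> span {a}" using span_base[of b "{b}"] by simp
    ultimately obtain c d where "b = c *\<^sub>R a" "v - w = d *\<^sub>R a"
      unfolding span_singleton by blast
    hence bv: "b = c *\<^sub>R a" "v = w + d *\<^sub>R a" by (simp_all add: algebra_simps)
    have c: "c \<noteq> 0" using a(2) bv(1) by auto
    have "((v \<bullet> a) / (a \<bullet> a)) = (w \<bullet> a) / (a \<bullet> a) + d"
      using a(1) by (simp add: bv(2) inner_add_left add_divide_distrib)
    moreover have "((w \<bullet> b) / (b \<bullet> b)) *\<^sub>R b = ((w \<bullet> a) / (a \<bullet> a)) *\<^sub>R a"
      using c by (simp add: bv(1) power2_eq_square)
    ultimately show ?thesis
      by (simp add: r_def bv(2) scaleR_add_left flip: a_def b_def)
  qed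
  have "\<exists>p. continuous_map Y_P_bar euclidean p \<and> (\<forall>x\<in>carrier aff_GL2. p (?\<kappa> x) = r x)"
  proof (rule quotient_map_lift_exists[OF quotient_map_Y_P_bar r])
    show "r x = r y"
      if "x \<in> topspace (top_of_set (carrier aff_GL2))" "y \<in> topspace (top_of_set (carrier aff_GL2))"
        "?\<kappa> x = ?\<kappa> y" for x y
      using that by (cases x; cases y) (auto intro!: const)
  qed auto
  then obtain p where p: "continuous_map Y_P_bar euclidean p"
      "\<And>x. x \<in> carrier aff_GL2 \<Longrightarrow> p (?\<kappa> x) = r x"
    by blast
  have "p (Y_P_point F v) - v \<in> F" if F: "F \<in> topspace P1_real" for F v
  proof -
    obtain A :: "real ^ 2 ^ 2" where A: "invertible A" "span {column 2 A} = F"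
      using F by (rule matrix_with_column_span)
    have "p (Y_P_point F v) - v = - ((v \<bullet> column 2 A) / (column 2 A \<bullet> column 2 A)) *\<^sub>R column 2 A"
      using p(2)[of "(v, A)"] A by (simp add: r_def)
    also have "\<dots> \<in> span {column 2 A}"
      by (intro span_scale span_base) simp
    finally show ?thesis using A(2) by simp
  qed
  with p(1) show ?thesis by (rule that)
qed

section \<open>Leaves as double cosets\<close>

lemma leaf_eq_iff:
  assumes M: "0 \<in> M" "\<And>x y. x \<in> M \<Longrightarrow> y \<in> M \<Longrightarrow> x + y \<in> M" "\<And>x. x \<in> M \<Longrightarrow> - x \<in> M"
    and F: "subspace F"
  shows "leaf M F v = leaf M F w \<longleftrightarrow> (\<exists>m\<in>M. m + v - w \<in> F)"
proof
  assume eq: "leaf M F v = leaf M F w"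
  have "w \<in> leaf M F w"
    unfolding leaf_def using M(1) subspace_0[OF F] by force
  then obtain m f where "m \<in> M" "f \<in> F" "w = m + v + f"
    unfolding eq[symmetric] by (auto simp: leaf_def)
  hence "m \<in> M" "m + v - w = - f" "- f \<in> F"
    using subspace_neg[OF F] by (auto simp: algebra_simps)
  thus "\<exists>m\<in>M. m + v - w \<in> F" by metis
next
  assume "\<exists>m\<in>M. m + v - w \<in> F"
  then obtain m where m: "m \<in> M" "m + v - w \<in> F" by blast
  show "leaf M F v = leaf M F w"
  proof (intro equalityI subsetI)
    fix x assume "x \<in> leaf M F v"
    then obtain n f where nf: "n \<in> M" "f \<in> F" "x = n + v + f"
      unfolding leaf_def by blast
    have "x = (n + - m) + w + (f + (m + v - w))"
      by (simp add: nf algebra_simps)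
    thus "x \<in> leaf M F w"
      unfolding leaf_def using nf m M(2)[OF nf(1) M(3)[OF m(1)]] subspace_add[OF F nf(2) m(2)] by blast
  next
    fix x assume "x \<in> leaf M F w"
    then obtain n f where nf: "n \<in> M" "f \<in> F" "x = n + w + f"
      unfolding leaf_def by blast
    have "x = (n + m) + v + (f - (m + v - w))"
      by (simp add: nf algebra_simps)
    thus "x \<in> leaf M F v"
      unfolding leaf_def using nf m M(2)[OF nf(1) m(1)] subspace_diff[OF F nf(2) m(2)] by blast
  qed
qed

lemma leaf_image:
  assumes "linear \<alpha>" "\<alpha> ` M = M" "\<alpha> ` F = F"
  shows "\<alpha> ` leaf M F v = leaf M F (\<alpha> v)"
proof (intro equalityI subsetI)
  fix x assume "x \<in> \<alpha> ` leaf M F v"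
  then obtain m f where "m \<in> M" "f \<in> F" "x = \<alpha> m + \<alpha> v + \<alpha> f"
    using assms(1) by (auto simp: leaf_def linear_add)
  moreover from this have "\<alpha> m \<in> M" "\<alpha> f \<in> F"
    using assms(2,3) by blast+
  ultimately show "x \<in> leaf M F (\<alpha> v)"
    unfolding leaf_def by blast
next
  fix x assume "x \<in> leaf M F (\<alpha> v)"
  then obtain m f where "m \<in> \<alpha> ` M" "f \<in> \<alpha> ` F" "x = m + \<alpha> v + f"
    unfolding leaf_def assms(2,3) by blast
  then obtain m f where "m \<in> M" "f \<in> F" "x = \<alpha> (m + v + f)"
    using assms(1) by (auto simp: linear_add)
  thus "x \<in> \<alpha> ` leaf M F v"
    unfolding leaf_def by blast
qed

section \<open>The space of leaves\<close>

definition int_lattice :: "(real ^ 2) set"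
  where "int_lattice = {v. \<forall>i. v $ i \<in> \<int>}"

text \<open>Translations come from \<open>P(Q)\<close> as rational vectors but act on
  \<open>R^2\<close> through \<open>of_rat\<close>; on vectors with integer entries this is a
  bijection with the real lattice.\<close>

lemma Ex_integral_rat_vector_iff:
  "(\<exists>m :: rat ^ 2. (\<forall>i. m $ i \<in> \<int>) \<and> P (\<chi> i. of_rat (m $ i))) \<longleftrightarrow> (\<exists>m\<in>int_lattice. P m)"
proof
  have of_rat_Ints: "real_of_rat q \<in> \<int>" if "q \<in> \<int>" for q
    using that by (auto elim!: Ints_cases)
  assume "\<exists>m :: rat ^ 2. (\<forall>i. m $ i \<in> \<int>) \<and> P (\<chi> i. of_rat (m $ i))"
  then obtain m :: "rat ^ 2" where "\<forall>i. m $ i \<in> \<int>" "P (\<chi> i. of_rat (m $ i))"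
    by blast
  moreover from this have "(\<chi> i. real_of_rat (m $ i)) \<in> int_lattice"
    by (simp add: int_lattice_def of_rat_Ints)
  ultimately show "\<exists>m\<in>int_lattice. P m" by blast
next
  assume "\<exists>m\<in>int_lattice. P m"
  then obtain m where m: "\<forall>i. m $ i \<in> \<int>" "P m"
    by (auto simp: int_lattice_def)
  then obtain z where z: "\<And>i. m $ i = of_int (z i)"
    unfolding Ints_def image_iff by metis
  have "(\<chi> i. real_of_rat ((\<chi> i. rat_of_int (z i)) $ i)) = m"
    by (simp add: vec_eq_iff z)
  with m(2) show "\<exists>m :: rat ^ 2. (\<forall>i. m $ i \<in> \<int>) \<and> P (\<chi> i. of_rat (m $ i))"
    by (intro exI[of _ "\<chi> i. rat_of_int (z i)"]) simp
qed

section \<open>Objects in normal form and the fibre\<close>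

lemma Y_P_point_in_Y_P_bar: "F \<in> topspace P1_real \<Longrightarrow> Y_P_point F v \<in> topspace Y_P_bar"
  by (auto simp: topspace_Y_P_bar)

lemma Y_P_point_in_level_space:
  "F \<in> topspace P1_real \<Longrightarrow> (Y_P_point F v, aff_zhat) \<in> topspace (level_space aff_datum aff_zhat)"
  using aff.level_in_lcosets by (simp add: aff.topspace_level_space Y_P_point_in_Y_P_bar)

text \<open>A rational element preserving the trivial coset lies in
  \<open>P(Q) \<inter> P(Zhat) = P(Z)\<close>. Equality of fibre classes and of \<open>Sh\<close>
  classes are both read off from this.\<close>

lemma level_act_Y_P_point_eq_iff:
  assumes F: "F \<in> topspace P1_real" "F' \<in> topspace P1_real" and Q: "invertible Q"
  shows "level_act aff_datum (m, Q) (Y_P_point F v, aff_zhat) = (Y_P_point F' v', aff_zhat) \<longleftrightarrow>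
    (*v) (map_matrix of_rat Q) ` F = F' \<and>
    (\<chi> i. of_rat (m $ i)) + map_matrix of_rat Q *v v - v' \<in> F' \<and>
    (\<forall>i. m $ i \<in> \<int>) \<and> Q \<in> map_matrix of_int ` carrier GL2"
proof -
  have "level_act aff_datum (m, Q) (Y_P_point F v, aff_zhat) = (Y_P_point F' v', aff_zhat) \<longleftrightarrow>
      conj_cochar (map_aff of_rat (m, Q)) ` Y_P_point F v = Y_P_point F' v' \<and>
      map_aff rat_to_adele (m, Q) \<in> aff_zhat"
    using aff.translate_level_iff[of "(m, Q)"] Q by (simp add: level_act_def)
  thus ?thesis
    using image_P1_real[OF rat_to_real.invertible_map_matrix[OF Q] F(1)] F(2)
    by (auto simp: action_Y_P_point Q Y_P_point_eq_iff rat_aff_in_aff_zhat_iff)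
qed

text \<open>An identification that is the identity before and after forces the linear part of the
  moving element to be the identity, which leaves integral translations.\<close>

lemma fibre_class_Y_P_point_eq_iff:
  assumes F: "F \<in> topspace P1_real"
  shows "fibre_class aff_proj aff_datum GL2_datum ((Y_P_point F v, aff_zhat), mat 1) =
      fibre_class aff_proj aff_datum GL2_datum ((Y_P_point F v', aff_zhat), mat 1) \<longleftrightarrow>
    (\<exists>m\<in>int_lattice. m + v - v' \<in> F)"
proof -
  have "mat 1 \<in> map_matrix rat_of_int ` carrier GL2"
    by (rule image_eqI[of _ _ "mat 1"])
      (simp_all add: int_to_rat.map_matrix_one invertible_def[of "mat 1"])
  hence inv_one: "invertible (mat 1 :: rat ^ 2 ^ 2)" "mat 1 \<in> map_matrix rat_of_int ` carrier GL2"
    by (auto simp: invertible_def[of "mat 1"])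
  have one: "mat 1 \<otimes>\<^bsub>GL2\<^esub> inv\<^bsub>GL2\<^esub> Q = mat 1 \<longleftrightarrow> Q = mat 1" if "invertible Q" for Q :: "rat ^ 2 ^ 2"
    using group.inv_eq_1_iff[OF group_GL2, of Q] that by simp
  have "fibre_class aff_proj aff_datum GL2_datum ((Y_P_point F v, aff_zhat), mat 1) =
      fibre_class aff_proj aff_datum GL2_datum ((Y_P_point F v', aff_zhat), mat 1) \<longleftrightarrow>
      (\<exists>q\<in>carrier aff_GL2. level_act aff_datum q (Y_P_point F v, aff_zhat) = (Y_P_point F v', aff_zhat) \<and>
        mat 1 \<otimes>\<^bsub>GL2\<^esub> inv\<^bsub>GL2\<^esub> (snd q) = mat 1)"
    using aff_GL2.fibre_class_eq_iff[OF Y_P_point_in_level_space[OF F] _ Y_P_point_in_level_space[OF F]]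
      inv_one by simp
  also have "\<dots> \<longleftrightarrow> (\<exists>m. level_act aff_datum (m, mat 1) (Y_P_point F v, aff_zhat) = (Y_P_point F v', aff_zhat))"
    using inv_one(1) one by (auto simp del: mult_GL2)
  also have "\<dots> \<longleftrightarrow> (\<exists>m :: rat ^ 2. (\<forall>i. m $ i \<in> \<int>) \<and> (\<chi> i. of_rat (m $ i)) + v - v' \<in> F)"
    using inv_one by (auto simp: level_act_Y_P_point_eq_iff F rat_to_real.map_matrix_one)
  also have "\<dots> \<longleftrightarrow> (\<exists>m\<in>int_lattice. m + v - v' \<in> F)"
    by (rule Ex_integral_rat_vector_iff)
  finally show ?thesis .
qed

text \<open>Without identifications the linear part may be any element of \<open>GL2(Z)\<close>
  preserving the line; this is where the automorphisms of the pre-lilac enter.\<close>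

lemma Sh_class_Y_P_point_eq_iff:
  assumes F: "F \<in> topspace P1_real"
  shows "Sh_class aff_datum (Y_P_point F v, aff_zhat) = Sh_class aff_datum (Y_P_point F v', aff_zhat) \<longleftrightarrow>
    (\<exists>Z :: int ^ 2 ^ 2. invertible Z \<and> (*v) (map_matrix of_int Z) ` F = F \<and>
      (\<exists>m\<in>int_lattice. m + map_matrix of_int Z *v v - v' \<in> F))"
proof -
  have "Sh_class aff_datum (Y_P_point F v, aff_zhat) = Sh_class aff_datum (Y_P_point F v', aff_zhat) \<longleftrightarrow>
      (\<exists>Q m. invertible Q \<and>
        level_act aff_datum (m, Q) (Y_P_point F v, aff_zhat) = (Y_P_point F v', aff_zhat))"
    using aff.Sh_class_eq_iff[OF Y_P_point_in_level_space[OF F] Y_P_point_in_level_space[OF F]]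
    by auto
  also have "\<dots> \<longleftrightarrow> (\<exists>Q. Q \<in> map_matrix of_int ` carrier GL2 \<and> (*v) (map_matrix of_rat Q) ` F = F \<and>
      (\<exists>m :: rat ^ 2. (\<forall>i. m $ i \<in> \<int>) \<and> (\<chi> i. of_rat (m $ i)) + map_matrix of_rat Q *v v - v' \<in> F))"
  proof -
    have "invertible Q" if "Q \<in> map_matrix rat_of_int ` carrier GL2" for Q
      using that int_to_rat.invertible_map_matrix by auto
    thus ?thesis
      using level_act_Y_P_point_eq_iff[OF F F] by metis
  qed
  also have "\<dots> \<longleftrightarrow> (\<exists>Q. Q \<in> map_matrix of_int ` carrier GL2 \<and> (*v) (map_matrix of_rat Q) ` F = F \<and>
      (\<exists>m\<in>int_lattice. m + map_matrix of_rat Q *v v - v' \<in> F))"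
    unfolding Ex_integral_rat_vector_iff[where P = "\<lambda>m. m + map_matrix of_rat _ *v v - v' \<in> F"] ..
  also have "\<dots> \<longleftrightarrow> (\<exists>Z :: int ^ 2 ^ 2. invertible Z \<and>
      (*v) (map_matrix of_rat (map_matrix of_int Z)) ` F = F \<and>
      (\<exists>m\<in>int_lattice. m + map_matrix of_rat (map_matrix of_int Z) *v v - v' \<in> F))"
    by (simp only: image_iff Bex_def carrier_GL2) blast
  finally show ?thesis
    unfolding of_rat_of_int_matrix .
qed

lemma level_map_Y_P_point:
  assumes "F \<in> topspace P1_real"
  shows "level_map aff_proj GL2_datum GL2_zhat (Y_P_point F v, aff_zhat) = (F, GL2_zhat)"
proof -
  have "level_map aff_proj GL2_datum GL2_zhat (Y_P_point F v, \<one>\<^bsub>aff_GL2\<^esub> <#\<^bsub>aff_GL2\<^esub> aff_zhat) =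
      (on_space aff_proj (Y_P_point F v), mat 1 <#\<^bsub>GL2\<^esub> GL2_zhat)"
    using aff_GL2.level_map_coset[of "\<one>\<^bsub>aff_GL2\<^esub>"]
    by (simp add: one_aff_GL2 invertible_def[of "mat 1"])
  moreover have "\<one>\<^bsub>aff_GL2\<^esub> <#\<^bsub>aff_GL2\<^esub> aff_zhat = aff_zhat" "\<one>\<^bsub>GL2\<^esub> <#\<^bsub>GL2\<^esub> GL2_zhat = GL2_zhat"
    using aff.adele.lcos_mult_one[OF aff.level_subset] GL2.adele.lcos_mult_one[OF GL2.level_subset]
    by simp_all
  ultimately show ?thesis
    using on_space_Y_P_point[OF assms] by simp
qed

text \<open>A translation on the left does not affect the linear part, so only the entries of
  \<open>g *v w\<close> have to become integral. The negatives of their rational parts achieve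
  this.\<close>

lemma clear_translation:
  assumes "g ** A \<in> GL2_zhat"
  obtains k where "(k + g *v w, g ** A) \<in> aff_zhat" "\<exists>m. k = (\<chi> i. rat_to_adele (m $ i))"
proof -
  have "\<exists>q a. (g *v w) $ i = rat_to_adele q + zhat_to_adele a" for i
    by (rule adele_rat_plus_zhat)
  then obtain q a where qa: "\<And>i. (g *v w) $ i = rat_to_adele (q i) + zhat_to_adele (a i)"
    by metis
  define m where "m = (\<chi> i. - q i)"
  have "((\<chi> i. rat_to_adele (m $ i)) + g *v w, g ** A) \<in> aff_zhat"
    using assms by (simp add: mem_aff_zhat_iff qa m_def rat_to_adele.hom_uminus)
  thus ?thesis using that by blast
qed

text \<open>Stated for an arbitrary quotient of \<open>R^2\<close> with the leaf relation, so that a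
  marking can supply the leaf space of an abstract \<open>M\<close>.\<close>

lemma fibre_over_homeomorphic:
  assumes F: "F \<in> topspace P1_real"
    and \<pi>: "quotient_map euclidean Z \<pi>"
    and \<pi>_eq: "\<And>v v'. \<pi> v = \<pi> v' \<longleftrightarrow> (\<exists>m\<in>int_lattice. m + v - v' \<in> F)"
  obtains f where
    "homeomorphic_map Z (fibre_over aff_proj aff_datum aff_zhat GL2_datum GL2_zhat (F, GL2_zhat)) f"
    "\<And>v. f (\<pi> v) = fibre_class aff_proj aff_datum GL2_datum ((Y_P_point F v, aff_zhat), mat 1)"
proof -
  let ?B = "fibre_objects aff_proj aff_datum aff_zhat GL2_datum GL2_zhat (F, GL2_zhat)"
  let ?\<rho> = "fibre_class aff_proj aff_datum GL2_datum"
  obtain p where p: "continuous_map Y_P_bar euclidean p"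
      "\<And>F v. F \<in> topspace P1_real \<Longrightarrow> p (Y_P_point F v) - v \<in> F"
    using Y_P_bar_representative by blast
  define i where "i = (\<lambda>v. ((Y_P_point F v, aff_zhat), mat 1 :: rat ^ 2 ^ 2))"
  have inv_one: "invertible (mat 1 :: rat ^ 2 ^ 2)"
    by (auto simp: invertible_def[of "mat 1"])
  have i_obj: "i v \<in> topspace ?B" for v
    unfolding i_def aff_GL2.topspace_fibre_objects
    using F GL2.level_act_one[of "(F, GL2_zhat)"] GL2.level_in_lcosets
    by (simp add: level_map_Y_P_point Y_P_point_in_level_space GL2.topspace_level_space inv_one)

  have "continuous_map euclidean Y_P_bar (Y_P_point F)"
  proof -
    obtain A :: "real ^ 2 ^ 2" where A: "invertible A" "span {column 2 A} = F"
      using F by (rule matrix_with_column_span)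
    have "continuous_map euclidean (top_of_set (carrier aff_GL2)) (\<lambda>v. (v, A))"
      using A by (auto simp: continuous_map_in_subtopology intro!: continuous_intros)
    hence "continuous_map euclidean Y_P_bar
        ((\<lambda>(v, A). Y_P_point (span {column 2 A}) v) \<circ> (\<lambda>v. (v, A)))"
      using quotient_imp_continuous_map[OF quotient_map_Y_P_bar] continuous_map_compose by blast
    thus ?thesis by (simp add: A(2) o_def)
  qed
  hence i: "continuous_map euclidean ?B i"
    using i_obj aff.level_in_lcosets inv_one
    unfolding fibre_objects_def continuous_map_in_subtopology level_space_def
    by (auto simp: i_def continuous_map_pairwise o_def)

  \<comment> \<open>The element moving an object into standard position depends only on its discrete
    coordinates, so it can be chosen without destroying continuity.\<close>
  define good where "good = (\<lambda>c g q. snd q = g \<and> map_aff rat_to_adele q <#\<^bsub>aff_GL2\<^esub> c = aff_zhat)"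
  \<comment> \<open>The implication makes \<open>r\<close> total even where no good element exists.
    Objects of the fibre always have one, as shown within \<open>retract\<close>.\<close>
  have "\<exists>q\<in>carrier aff_GL2. (\<exists>q'\<in>carrier aff_GL2. good c g q') \<longrightarrow> good c g q" for c g
    using aff.rat.one_closed by auto
  then obtain r where r: "\<And>c g. r c g \<in> carrier aff_GL2"
      "\<And>c g q. q \<in> carrier aff_GL2 \<Longrightarrow> good c g q \<Longrightarrow> good c g (r c g)"
    by metis
  define s where "s = (\<lambda>((x, c), g). p (conj_cochar (map_aff of_rat (r c g)) ` x))"
  have "continuous_map Y_P_bar euclidean (\<lambda>x. p (conj_cochar (map_aff of_rat (r c g)) ` x))" for c g
    using continuous_map_compose[OF aff.action_continuous, of "r c g" euclidean p] p(1) r(1)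
    by (simp add: o_def)
  hence s: "continuous_map ?B euclidean s"
    unfolding fibre_objects_def level_space_def
    by (intro continuous_map_from_subtopology continuous_map_prod_discrete) (simp add: s_def)

  have retract: "?\<rho> (i (s b)) = ?\<rho> b" if "b \<in> topspace ?B" for b
  proof -
    obtain x c g where b: "b = ((x, c), g)" by (metis surj_pair)
    hence obj: "(x, c) \<in> topspace (level_space aff_datum aff_zhat)" "invertible g"
        "level_act GL2_datum g (level_map aff_proj GL2_datum GL2_zhat (x, c)) = (F, GL2_zhat)"
      using that by (auto simp: aff_GL2.topspace_fibre_objects)
    then obtain G v a where x: "x = Y_P_point G v" "G \<in> topspace P1_real"
        and c: "c = a <#\<^bsub>aff_GL2\<^esub> aff_zhat" "a \<in> carrier aff_GL2"
      by (auto simp: aff.topspace_level_space lcosets_iff topspace_Y_P_bar)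
    obtain w A where a: "a = (w, A)" "invertible A"
      using c(2) by (cases a) auto
    have "level_map aff_proj GL2_datum GL2_zhat (x, c) = (G, A <#\<^bsub>GL2\<^esub> GL2_zhat)"
      using aff_GL2.level_map_coset[of a x] c on_space_Y_P_point[OF x(2)] by (simp add: x a)
    with obj(3) have gG: "(*v) (map_matrix of_rat g) ` G = F"
      and "map_matrix rat_to_adele g <#\<^bsub>GL2\<^esub> (A <#\<^bsub>GL2\<^esub> GL2_zhat) = GL2_zhat"
      by (simp_all add: level_act_def)
    hence "(map_matrix rat_to_adele g ** A) <#\<^bsub>GL2\<^esub> GL2_zhat = GL2_zhat"
      using GL2.translate_coset[of g A] obj(2) a(2) by simp
    hence "map_matrix rat_to_adele g ** A \<in> GL2_zhat"
      using GL2.adele.l_coset_eq_subgroup_iff[OF GL2.subgroup_level] obj(2) a(2)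
      by (simp add: invertible_mult rat_to_adele.invertible_map_matrix)
    then obtain k m where k: "(k + map_matrix rat_to_adele g *v w, map_matrix rat_to_adele g ** A) \<in> aff_zhat"
        "k = (\<chi> i. rat_to_adele (m $ i))"
      using clear_translation[of "map_matrix rat_to_adele g" A w] by blast
    have "map_aff rat_to_adele (m, g) <#\<^bsub>aff_GL2\<^esub> c =
        (map_aff rat_to_adele (m, g) \<otimes>\<^bsub>aff_GL2\<^esub> a) <#\<^bsub>aff_GL2\<^esub> aff_zhat"
      using aff.translate_coset[of "(m, g)" a] obj(2) c by simp
    also have "\<dots> = aff_zhat"
      using aff.adele.l_coset_eq_subgroup_iff[OF aff.subgroup_level] k obj(2) a
      by (simp add: map_aff_pair invertible_mult rat_to_adele.invertible_map_matrix)
    finally have "good c g (m, g)"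
      by (simp add: good_def)
    hence "good c g (r c g)"
      using r(2)[of "(m, g)" c g] obj(2) by simp
    then obtain m' where r': "r c g = (m', g)" "map_aff rat_to_adele (m', g) <#\<^bsub>aff_GL2\<^esub> c = aff_zhat"
      unfolding good_def by (metis prod.collapse)
    define v' where "v' = (\<chi> i. of_rat (m' $ i)) + map_matrix of_rat g *v v"
    have act: "conj_cochar (map_aff of_rat (m', g)) ` x = Y_P_point F v'"
      by (simp add: x(1) action_Y_P_point obj(2) gG v'_def)
    hence "s b = p (Y_P_point F v')"
      by (simp add: s_def b r'(1))
    \<comment> \<open>\<open>s b\<close> agrees with \<open>v'\<close> only modulo \<open>F\<close>,
      which is all that the point of \<open>Y_P_bar\<close> records.\<close>
    hence "Y_P_point F (s b) = Y_P_point F v'"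
      using p(2)[OF F] by (simp add: Y_P_point_eq_iff F)
    hence "level_act aff_datum (m', g) (x, c) = (Y_P_point F (s b), aff_zhat)"
      using act r'(2) by (simp add: level_act_def)
    \<comment> \<open>This is why \<open>good\<close> prescribes the linear part \<open>g\<close>:
      the identification becomes the identity.\<close>
    moreover have "g \<otimes>\<^bsub>GL2\<^esub> inv\<^bsub>GL2\<^esub> g = mat 1"
      using group.r_inv[OF group_GL2, of g] obj(2) by simp
    ultimately have "?\<rho> ((x, c), g) = ?\<rho> ((Y_P_point F (s b), aff_zhat), mat 1)"
      using aff_GL2.fibre_class_eq_iff[OF obj(1) _ Y_P_point_in_level_space[OF F]] obj(2) inv_one
      by (auto simp del: mult_GL2 intro!: bexI[of _ "(m', g)"])
    thus ?thesis by (simp add: i_def b)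
  qed

  show ?thesis
  proof (rule quotients_homeomorphic[OF \<pi> _ i s])
    show "?\<rho> (i (s b)) = ?\<rho> b" if "b \<in> topspace ?B" for b
      using that by (rule retract)
    show "quotient_map ?B (fibre_over aff_proj aff_datum aff_zhat GL2_datum GL2_zhat (F, GL2_zhat)) ?\<rho>"
      unfolding fibre_over_def by (rule quotient_map_quotient_topology)
    show "?\<rho> (i v) = ?\<rho> (i v') \<longleftrightarrow> \<pi> v = \<pi> v'" for v v'
      by (simp add: i_def fibre_class_Y_P_point_eq_iff F \<pi>_eq)
  qed (use that in \<open>auto simp: i_def\<close>)
qed

section \<open>Automorphisms of the lattice and of the pre-lilac\<close>

lemma linear_inv_if_bij:
  assumes "linear f" "bij f"
  shows "linear (inv_into UNIV f)"
proof (rule linearI)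
  have cancel: "inv_into UNIV f (f x) = x" "f (inv_into UNIV f y) = y" for x y
    using assms(2) by (simp_all add: bij_is_inj bij_is_surj surj_f_inv_f)
  show "inv_into UNIV f (x + y) = inv_into UNIV f x + inv_into UNIV f y" for x y
    using linear_add[OF assms(1), of "inv_into UNIV f x" "inv_into UNIV f y"] by (metis cancel)
  show "inv_into UNIV f (c *\<^sub>R x) = c *\<^sub>R inv_into UNIV f x" for c x
    using linear_scale[OF assms(1), of c "inv_into UNIV f x"] by (metis cancel)
qed

lemma int_lattice_closed:
  "0 \<in> int_lattice" "x \<in> int_lattice \<Longrightarrow> y \<in> int_lattice \<Longrightarrow> x + y \<in> int_lattice"
  "x \<in> int_lattice \<Longrightarrow> - x \<in> int_lattice"
  by (simp_all add: int_lattice_def)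

lemma int_matrix_in_int_lattice: "v \<in> int_lattice \<Longrightarrow> map_matrix of_int Z *v v \<in> int_lattice"
  by (auto simp: int_lattice_def matrix_vector_mult_def intro!: Ints_sum Ints_mult)

lemma int_matrix_image_int_lattice:
  assumes "invertible Z"
  shows "(*v) (map_matrix of_int Z) ` int_lattice = int_lattice"
proof (intro equalityI subsetI)
  obtain Y where Y: "Z ** Y = mat 1"
    using assms by (auto simp: invertible_def)
  fix v assume v: "v \<in> int_lattice"
  have "v = map_matrix of_int Z *v (map_matrix of_int Y *v v)"
    by (simp add: matrix_vector_mul_assoc Y int_to_real.map_matrix_one flip: int_to_real.map_matrix_mult)
  thus "v \<in> (*v) (map_matrix of_int Z) ` int_lattice"
    using int_matrix_in_int_lattice[OF v] by blast
qed (auto simp: int_matrix_in_int_lattice)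

lemma linear_int_lattice_matrix:
  assumes \<beta>: "linear \<beta>" "\<beta> ` int_lattice \<subseteq> int_lattice"
  obtains Z :: "int ^ 2 ^ 2" where "\<beta> = (*v) (map_matrix of_int Z)"
proof -
  have "matrix \<beta> $ i $ j \<in> \<int>" for i j
  proof -
    have "axis j 1 \<in> int_lattice" by (simp add: int_lattice_def axis_def)
    hence "\<beta> (axis j 1) \<in> int_lattice" using \<beta>(2) by blast
    thus ?thesis by (simp add: matrix_def int_lattice_def)
  qed
  then obtain z where "\<And>i j. matrix \<beta> $ i $ j = of_int (z i j)"
    unfolding Ints_def image_iff by metis
  hence "matrix \<beta> = map_matrix of_int (\<chi> i j. z i j)"
    by (simp add: vec_eq_iff)
  moreover have "\<beta> = (*v) (matrix \<beta>)"
    using matrix_vector_mul(2)[OF \<beta>(1)] by auto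
  ultimately show ?thesis using that by metis
qed

text \<open>Both the map and its inverse preserve the lattice, so both have integer matrices; these
  are inverse over Z because Z embeds in R.\<close>

lemma int_lattice_automorphism_matrix:
  assumes \<beta>: "linear \<beta>" "bij \<beta>" "\<beta> ` int_lattice = int_lattice"
  obtains Z :: "int ^ 2 ^ 2" where "invertible Z" "\<beta> = (*v) (map_matrix of_int Z)"
proof -
  obtain Z :: "int ^ 2 ^ 2" where Z: "\<beta> = (*v) (map_matrix of_int Z)"
    using \<beta>(1,3) by (rule linear_int_lattice_matrix[OF _ equalityD1])
  have cancel: "inv_into UNIV \<beta> (\<beta> v) = v" "\<beta> (inv_into UNIV \<beta> v) = v" for v
    using \<beta>(2) by (simp_all add: bij_is_inj bij_is_surj surj_f_inv_f)
  have "linear (inv_into UNIV \<beta>)"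
    using \<beta>(1,2) by (rule linear_inv_if_bij)
  moreover have "inv_into UNIV \<beta> ` \<beta> ` int_lattice = int_lattice"
    by (simp add: image_image cancel)
  hence "inv_into UNIV \<beta> ` int_lattice \<subseteq> int_lattice"
    by (simp add: \<beta>(3))
  ultimately obtain Y :: "int ^ 2 ^ 2" where Y: "inv_into UNIV \<beta> = (*v) (map_matrix of_int Y)"
    by (rule linear_int_lattice_matrix)
  have "map_matrix real_of_int (Z ** Y) *v v = mat 1 *v v"
       "map_matrix real_of_int (Y ** Z) *v v = mat 1 *v v" for v
    using cancel[of v, unfolded Y, unfolded Z]
    by (simp_all add: int_to_real.map_matrix_mult matrix_vector_mul_assoc)
  hence "map_matrix real_of_int (Z ** Y) = map_matrix of_int (mat 1)"
       "map_matrix real_of_int (Y ** Z) = map_matrix of_int (mat 1)"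
    by (auto simp: int_to_real.map_matrix_one matrix_eq)
  hence "Z ** Y = mat 1" "Y ** Z = mat 1"
    by (simp_all add: vec_eq_iff)
  hence "invertible Z" by (rule invertibleI)
  thus ?thesis using Z by (rule that)
qed

text \<open>The marking pulls \<open>M\<close> back to \<open>Z^2\<close> and \<open>F\<close> back
  to a line in \<open>R^2\<close>, which gives the relation expected by
  \<open>fibre_over_homeomorphic\<close>.\<close>

lemma marking_leaf_eq_iff:
  assumes \<phi>: "linear \<phi>" "bij \<phi>" "\<phi> ` int_lattice = M" and F: "subspace F"
  shows "leaf M F (\<phi> v) = leaf M F (\<phi> w) \<longleftrightarrow> (\<exists>m\<in>int_lattice. m + v - w \<in> \<phi> -` F)"
proof -
  have "leaf M F (\<phi> v) = leaf M F (\<phi> w) \<longleftrightarrow> (\<exists>m\<in>M. m + \<phi> v - \<phi> w \<in> F)"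
  proof (rule leaf_eq_iff[OF _ _ _ F])
    show "0 \<in> M"
      using \<phi>(1,3) int_lattice_closed(1) linear_0 by (metis image_eqI)
    show "x + y \<in> M" if "x \<in> M" "y \<in> M" for x y
      using that int_lattice_closed(2) unfolding \<phi>(3)[symmetric]
      by (auto simp: linear_add[OF \<phi>(1), symmetric])
    show "- x \<in> M" if "x \<in> M" for x
      using that int_lattice_closed(3) unfolding \<phi>(3)[symmetric]
      by (auto simp: linear_neg[OF \<phi>(1), symmetric])
  qed
  thus ?thesis
    unfolding \<phi>(3)[symmetric] by (simp add: linear_add[OF \<phi>(1)] linear_diff[OF \<phi>(1)])
qed

text \<open>Conjugation by the marking matches automorphisms of \<open>(M, F)\<close> with elements
  of \<open>GL2(Z)\<close> preserving the pulled back line.\<close>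

lemma lilac_aut_iff_int_matrix:
  assumes \<phi>: "linear \<phi>" "bij \<phi>" "\<phi> ` int_lattice = M" and F: "subspace F"
  shows "(\<exists>\<alpha>\<in>lilac_aut M F. \<alpha> ` leaf M F (\<phi> v) = leaf M F (\<phi> w)) \<longleftrightarrow>
    (\<exists>Z :: int ^ 2 ^ 2. invertible Z \<and> (*v) (map_matrix of_int Z) ` (\<phi> -` F) = \<phi> -` F \<and>
      (\<exists>m\<in>int_lattice. m + map_matrix of_int Z *v v - w \<in> \<phi> -` F))"
proof -
  have cancel: "inv_into UNIV \<phi> (\<phi> x) = x" "\<phi> (inv_into UNIV \<phi> y) = y" for x y
    using \<phi>(2) by (simp_all add: bij_is_inj bij_is_surj surj_f_inv_f)
  have lin_inv: "linear (inv_into UNIV \<phi>)"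
    using \<phi>(1,2) by (rule linear_inv_if_bij)
  have F_eq: "\<phi> ` (\<phi> -` F) = F"
    using \<phi>(2) by (simp add: bij_is_surj)
  have "inv_into UNIV \<phi> ` \<phi> ` (\<phi> -` F) = \<phi> -` F"
    by (simp only: image_image cancel image_ident)
  hence F_inv: "inv_into UNIV \<phi> ` F = \<phi> -` F"
    by (simp only: F_eq)
  have "inv_into UNIV \<phi> ` \<phi> ` int_lattice = int_lattice"
    by (simp add: image_image cancel)
  hence M_inv: "inv_into UNIV \<phi> ` M = int_lattice"
    by (simp add: \<phi>(3))
  show ?thesis
  proof
    assume "\<exists>\<alpha>\<in>lilac_aut M F. \<alpha> ` leaf M F (\<phi> v) = leaf M F (\<phi> w)"
    then obtain \<alpha> where \<alpha>: "linear \<alpha>" "bij \<alpha>" "\<alpha> ` M = M" "\<alpha> ` F = F"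
        "\<alpha> ` leaf M F (\<phi> v) = leaf M F (\<phi> w)"
      by (auto simp: lilac_aut_def)
    define \<beta> where "\<beta> = inv_into UNIV \<phi> \<circ> \<alpha> \<circ> \<phi>"
    have "linear \<beta>" "bij \<beta>"
      unfolding \<beta>_def using \<alpha>(1,2) \<phi>(1,2) lin_inv bij_imp_bij_inv
      by (auto intro!: linear_compose bij_comp)
    moreover have "\<beta> ` int_lattice = int_lattice"
      unfolding \<beta>_def image_comp[symmetric] \<phi>(3) \<alpha>(3) M_inv ..
    ultimately obtain Z :: "int ^ 2 ^ 2" where Z: "invertible Z" "\<beta> = (*v) (map_matrix of_int Z)"
      by (rule int_lattice_automorphism_matrix)
    have "\<beta> ` (\<phi> -` F) = \<phi> -` F"
      unfolding \<beta>_def image_comp[symmetric] F_eq \<alpha>(4) F_inv ..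
    moreover have "leaf M F (\<phi> (\<beta> v)) = leaf M F (\<phi> w)"
      using \<alpha> leaf_image[of \<alpha> M F "\<phi> v"] by (simp add: \<beta>_def cancel)
    ultimately show "\<exists>Z :: int ^ 2 ^ 2. invertible Z \<and> (*v) (map_matrix of_int Z) ` (\<phi> -` F) = \<phi> -` F \<and>
        (\<exists>m\<in>int_lattice. m + map_matrix of_int Z *v v - w \<in> \<phi> -` F)"
      using Z marking_leaf_eq_iff[OF \<phi> F, of "\<beta> v" w] by (intro exI[of _ Z]) simp
  next
    assume "\<exists>Z :: int ^ 2 ^ 2. invertible Z \<and> (*v) (map_matrix of_int Z) ` (\<phi> -` F) = \<phi> -` F \<and>
        (\<exists>m\<in>int_lattice. m + map_matrix of_int Z *v v - w \<in> \<phi> -` F)"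
    then obtain Z :: "int ^ 2 ^ 2" where Z: "invertible Z" "(*v) (map_matrix of_int Z) ` (\<phi> -` F) = \<phi> -` F"
        "leaf M F (\<phi> (map_matrix of_int Z *v v)) = leaf M F (\<phi> w)"
      using marking_leaf_eq_iff[OF \<phi> F] by blast
    define \<alpha> where "\<alpha> = \<phi> \<circ> (*v) (map_matrix real_of_int Z) \<circ> inv_into UNIV \<phi>"
    have "bij ((*v) (map_matrix real_of_int Z))"
      using int_to_real.invertible_map_matrix[OF Z(1)] by (simp add: invertible_eq_bij)
    hence \<alpha>: "linear \<alpha>" "bij \<alpha>"
      unfolding \<alpha>_def using \<phi>(1,2) lin_inv bij_imp_bij_inv
      by (auto intro!: linear_compose bij_comp matrix_vector_mul_linear)
    have \<alpha>M: "\<alpha> ` M = M"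
      unfolding \<alpha>_def image_comp[symmetric] M_inv int_matrix_image_int_lattice[OF Z(1)] \<phi>(3) ..
    have \<alpha>F: "\<alpha> ` F = F"
      unfolding \<alpha>_def image_comp[symmetric] F_inv Z(2) F_eq ..
    have "\<alpha> ` leaf M F (\<phi> v) = leaf M F (\<phi> w)"
      using leaf_image[OF \<alpha>(1) \<alpha>M \<alpha>F, of "\<phi> v"] Z(3) by (simp add: \<alpha>_def cancel)
    thus "\<exists>\<alpha>\<in>lilac_aut M F. \<alpha> ` leaf M F (\<phi> v) = leaf M F (\<phi> w)"
      using \<alpha> \<alpha>M \<alpha>F by (auto simp: lilac_aut_def)
  qed
qed

text \<open>Prescribing \<open>f\<close> on leaves rules out an accidental homeomorphism. The last
  two clauses compare with the plain subset of \<open>Sh\<close>: forgetting identifications is onto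
  it and merges precisely the leaves related by an automorphism.\<close>

theorem lemma2p4p3:
  fixes M F :: "'w::euclidean_space set" and \<phi> :: "real ^ 2 \<Rightarrow> 'w"
  assumes "pre_lilac M F" and "marking \<phi> M"
  shows
    "(\<exists>j. homeomorphic_map (quotient_topology P1_real PGL2_int_orbit) (Sh GL2_datum GL2_zhat) j \<and>
         (\<forall>F0 \<in> topspace P1_real. j (PGL2_int_orbit F0) = Sh_class GL2_datum (F0, GL2_zhat))) \<and>
     (\<exists>f. homeomorphic_map
           (leaf_space M F)
           (fibre_over aff_proj aff_datum aff_zhat GL2_datum GL2_zhat (\<phi> -` F, GL2_zhat)) f \<and>
         (\<forall>u. f (leaf M F (\<phi> u)) =
                fibre_class aff_proj aff_datum GL2_datum
                  ((Y_P_point (\<phi> -` F) u, aff_zhat), mat 1)) \<and>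
         (fibre_to_Sh aff_datum \<circ> f) ` topspace (leaf_space M F) =
           {s \<in> topspace (Sh aff_datum aff_zhat).
              Sh_map aff_proj GL2_datum GL2_zhat s = Sh_class GL2_datum (\<phi> -` F, GL2_zhat)} \<and>
         (\<forall>\<L> \<in> topspace (leaf_space M F). \<forall>\<L>' \<in> topspace (leaf_space M F).
            fibre_to_Sh aff_datum (f \<L>) = fibre_to_Sh aff_datum (f \<L>') \<longleftrightarrow>
            (\<exists>\<alpha> \<in> lilac_aut M F. \<alpha> ` \<L> = \<L>')))"
proof -
  let ?F = "\<phi> -` F"
  have \<phi>: "linear \<phi>" "bij \<phi>" "\<phi> ` int_lattice = M"
    using assms(2) by (auto simp: marking_def int_lattice_def)
  have F: "subspace F" "dim F = 1"
    using assms(1) by (auto simp: pre_lilac_def)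
  have "\<phi> ` ?F = F" using \<phi>(2) by (simp add: bij_is_surj)
  moreover have "dim (\<phi> ` ?F) = dim ?F"
    using \<phi>(1,2) by (intro dim_image_eq) (auto intro: inj_on_subset[of \<phi> UNIV] bij_is_inj)
  ultimately have F': "?F \<in> topspace P1_real"
    using F \<phi>(1) by (simp add: topspace_P1_real linear_subspace_vimage)
  \<comment> \<open>A linear bijection in finite dimension is a homeomorphism, so the leaf space of
    \<open>M\<close> is presented as a quotient of \<open>R^2\<close>.\<close>
  have "homeomorphic_map euclidean euclidean \<phi>"
  proof -
    have "linear (inv_into UNIV \<phi>)"
      using \<phi>(1,2) by (rule linear_inv_if_bij)
    hence "homeomorphic_maps euclidean euclidean \<phi> (inv_into UNIV \<phi>)"
      using \<phi>(1,2) by (simp add: homeomorphic_maps_def linear_continuous_on linear_conv_bounded_linear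
          bij_is_inj bij_is_surj surj_f_inv_f)
    thus ?thesis by (rule homeomorphic_maps_imp_map)
  qed
  hence "quotient_map euclidean euclidean \<phi>"
    by (simp add: homeomorphic_map_def)
  hence "quotient_map euclidean (leaf_space M F) (leaf M F \<circ> \<phi>)"
    unfolding leaf_space_def by (rule quotient_map_compose[OF _ quotient_map_quotient_topology])
  moreover have "(leaf M F \<circ> \<phi>) v = (leaf M F \<circ> \<phi>) w \<longleftrightarrow> (\<exists>m\<in>int_lattice. m + v - w \<in> ?F)" for v w
    using marking_leaf_eq_iff[OF \<phi> F(1)] by simp
  ultimately obtain f where f: "homeomorphic_map (leaf_space M F)
        (fibre_over aff_proj aff_datum aff_zhat GL2_datum GL2_zhat (?F, GL2_zhat)) f"
      "\<And>v. f ((leaf M F \<circ> \<phi>) v) = fibre_class aff_proj aff_datum GL2_datum ((Y_P_point ?F v, aff_zhat), mat 1)"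
    by (rule fibre_over_homeomorphic[OF F']) blast
  have "(?F, GL2_zhat) \<in> topspace (level_space GL2_datum GL2_zhat)"
    using F' GL2.level_in_lcosets by (simp add: GL2.topspace_level_space)
  hence image: "(fibre_to_Sh aff_datum \<circ> f) ` topspace (leaf_space M F) =
      {s \<in> topspace (Sh aff_datum aff_zhat).
        Sh_map aff_proj GL2_datum GL2_zhat s = Sh_class GL2_datum (?F, GL2_zhat)}"
    unfolding image_comp[symmetric] homeomorphic_imp_surjective_map[OF f(1)]
    by (rule aff_GL2.fibre_to_Sh_image)
  have leaves: "fibre_to_Sh aff_datum (f \<L>) = fibre_to_Sh aff_datum (f \<L>') \<longleftrightarrow>
      (\<exists>\<alpha> \<in> lilac_aut M F. \<alpha> ` \<L> = \<L>')"
    if \<L>: "\<L> \<in> topspace (leaf_space M F)" "\<L>' \<in> topspace (leaf_space M F)" for \<L> \<L>'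
  proof -
    obtain v v' where v: "\<L> = leaf M F (\<phi> v)" "\<L>' = leaf M F (\<phi> v')"
      using \<L> \<phi>(2) by (auto simp: leaf_space_def) (metis bij_pointE)
    have "fibre_to_Sh aff_datum (f \<L>) = fibre_to_Sh aff_datum (f \<L>') \<longleftrightarrow>
        Sh_class aff_datum (Y_P_point ?F v, aff_zhat) = Sh_class aff_datum (Y_P_point ?F v', aff_zhat)"
      using f(2)[of v] f(2)[of v'] by (simp add: v aff_GL2.fibre_to_Sh_fibre_class)
    thus ?thesis
      unfolding v lilac_aut_iff_int_matrix[OF \<phi> F(1)] Sh_class_Y_P_point_eq_iff[OF F'] .
  qed
  obtain j where j: "homeomorphic_map (quotient_topology P1_real PGL2_int_orbit) (Sh GL2_datum GL2_zhat) j"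
    "\<And>F. F \<in> topspace P1_real \<Longrightarrow> j (PGL2_int_orbit F) = Sh_class GL2_datum (F, GL2_zhat)"
    using Sh_GL2_homeomorphic by blast
  show ?thesis
    by (intro conjI exI[of _ j] exI[of _ f] ballI allI)
      (rule j f(1) f(2)[unfolded o_apply] image leaves; assumption)+
qed

end
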